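(* Let $\rho$ be a finite type, $\rhd$ a relation on $\rho$, and $\succ,\succ_0$ formulas defining relations on $\rho$. Then $\mathrm{PA}^\omega$ proves: if $\succ_0$ is a decomposition of $\succ$ (with respect to $\rhd$), then the instance of $\mathrm{eTP}_\rho[\rhd]$ for $\succ$ implies the instance of $\mathrm{sTP}_\rho[\rhd]$ for $\succ,\succ_0$. Moreover, $\mathrm{PA}^\omega$ proves: if $\succ_0$ is a decomposition of $\succ$ and in addition $\forall x,y(x\succ_0 y\to x\succ y)$, then the instance of $\mathrm{sTP}_\rho[\rhd]$ for $\succ,\succ_0$ implies the instance of $\mathrm{eTP}_\rho[\rhd]$ for $\succ$.
   Context: Work in $\mathrm{PA}^\omega$, Peano arithmetic in all finite types (types generated from $\mathbb N$, $\mathbb B$ by function spaces, products and finite sequences; variables and quantifiers for all types, lambda-combinators and primitive recursors). For $x:\rho$ and $\alpha:\mathbb N\to\rho$, $x\blacktriangleleft\alpha$ means $\alpha_0=x$. Relations on $\rho$ are arbitrary formulas of $\mathrm{PA}^\omega$ in two variables of type $\rho$; $x\nsucc y$ means $\neg(x\succ y)$, $x\succeq y$ means $x\succ y\vee x=y$, and $y\lhd x$ means $x\rhd y$. $\mathrm{WF}[\succ](\alpha):\equiv\exists n(\alpha_n\nsucc\alpha_{n+1})$; $\mathrm{eWF}[\succ](x):\equiv\forall\alpha(x\blacktriangleleft\alpha\to\mathrm{WF}[\succ](\alpha))$. $\mathrm{eMIN}[\rhd,\succ](\alpha):\equiv\forall n\,\forall y^\rho(\alpha_{n-1}\succ y\wedge\alpha_n\rhd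 y\to\mathrm{eWF}[\succ](y))$, where for $n=0$ the condition $\alpha_{n-1}\succ y$ is omitted. The instance of $\mathrm{eTP}_\rho[\rhd]$ for $\succ$ is $\forall\alpha(\mathrm{eMIN}[\rhd,\succ](\alpha)\to\exists n(\alpha_n\nsucc\alpha_{n+1}))\to\forall x\,\mathrm{eWF}[\succ](x)$. $\succ_0$ is a decomposition of $\succ$ if (a) $\forall x,y(x\succ y\to\exists u(x\rhd u\wedge u\succeq y)\vee x\succ_0 y)$ and (b) $\forall x,y(x\succ_0 y\to\forall u(y\rhd u\to x\succ u))$. Let $A(x):\equiv\forall y(x\rhd y\to\mathrm{eWF}[\succ](y))$ and $\mathrm{eWF}_A[\rhd,\succ,\succ_0](x):\equiv\forall\alpha\big(\forall n A(\alpha_n)\wedge x\blacktriangleleft\alpha\to\exists n\,\neg(\alpha_n\succ_0\alpha_{n+1})\big)$. The instance of $\mathrm{sTP}_\rho[\rhd]$ for $\succ,\succ_0$ is $\forall x\,\mathrm{eWF}_A[\rhd,\succ,\succ_0](x)\to\forall x\,\mathrm{eWF}[\succ](x)$. *)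

theory Defs
  imports Main
begin

datatype ty =
    TNat
  | TBool
  | TFun ty ty  (infixr "\<^bold>\<Rightarrow>" 65)
  | TProd ty ty
  | TSeq ty

text \<open>
  Lambda abstraction is available through the combinators \<open>K\<close> and \<open>S\<close>, so terms have no binders.
\<close>

datatype con =
    CK ty ty
  | CS ty ty ty
  | CZero
  | CSuc
  | CRec ty
  | CTrue
  | CFalse
  | CIf ty
  | CPair ty ty
  | CFst ty ty
  | CSnd ty ty
  | CNil ty
  | CCons ty
  | CSeqRec ty ty

primrec con_type :: "con \<Rightarrow> ty" where
  "con_type (CK \<sigma> \<tau>) = \<sigma> \<^bold>\<Rightarrow> \<tau> \<^bold>\<Rightarrow> \<sigma>"
| "con_type (CS \<sigma> \<tau> \<upsilon>) = (\<sigma> \<^bold>\<Rightarrow> \<tau> \<^bold>\<Rightarrow> \<upsilon>) \<^bold>\<Rightarrow> (\<sigma> \<^bold>\<Rightarrow> \<tau>) \<^bold>\<Rightarrow> \<sigma> \<^bold>\<Rightarrow> \<upsilon>"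
| "con_type CZero = TNat"
| "con_type CSuc = TNat \<^bold>\<Rightarrow> TNat"
| "con_type (CRec \<sigma>) = \<sigma> \<^bold>\<Rightarrow> (TNat \<^bold>\<Rightarrow> \<sigma> \<^bold>\<Rightarrow> \<sigma>) \<^bold>\<Rightarrow> TNat \<^bold>\<Rightarrow> \<sigma>"
| "con_type CTrue = TBool"
| "con_type CFalse = TBool"
| "con_type (CIf \<sigma>) = \<sigma> \<^bold>\<Rightarrow> \<sigma> \<^bold>\<Rightarrow> TBool \<^bold>\<Rightarrow> \<sigma>"
| "con_type (CPair \<sigma> \<tau>) = \<sigma> \<^bold>\<Rightarrow> \<tau> \<^bold>\<Rightarrow> TProd \<sigma> \<tau>"
| "con_type (CFst \<sigma> \<tau>) = TProd \<sigma> \<tau> \<^bold>\<Rightarrow> \<sigma>"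
| "con_type (CSnd \<sigma> \<tau>) = TProd \<sigma> \<tau> \<^bold>\<Rightarrow> \<tau>"
| "con_type (CNil \<sigma>) = TSeq \<sigma>"
| "con_type (CCons \<sigma>) = \<sigma> \<^bold>\<Rightarrow> TSeq \<sigma> \<^bold>\<Rightarrow> TSeq \<sigma>"
| "con_type (CSeqRec \<sigma> \<tau>) = \<tau> \<^bold>\<Rightarrow> (\<sigma> \<^bold>\<Rightarrow> TSeq \<sigma> \<^bold>\<Rightarrow> \<tau> \<^bold>\<Rightarrow> \<tau>) \<^bold>\<Rightarrow> TSeq \<sigma> \<^bold>\<Rightarrow> \<tau>"

text \<open>
  Locally nameless syntax: \<open>Free x \<sigma>\<close> is a free variable of type \<open>\<sigma>\<close> (the name \<open>x\<close> at different types
  gives different variables), \<open>Bound i\<close> a de Bruijn index.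
\<close>

datatype tm =
    Free nat ty
  | Bound nat
  | Con con
  | App tm tm  (infixl "\<cdot>" 200)

abbreviation zero :: tm where "zero \<equiv> Con CZero"
abbreviation suc :: "tm \<Rightarrow> tm" where "suc t \<equiv> Con CSuc \<cdot> t"

datatype fm =
    Eq tm tm  (infix "\<^bold>=" 50)
  | Falsum  ("\<^bold>\<bottom>")
  | And fm fm  (infixr "\<^bold>\<and>" 35)
  | Or fm fm  (infixr "\<^bold>\<or>" 30)
  | Imp fm fm  (infixr "\<^bold>\<longrightarrow>" 25)
  | All ty fm
  | Ex ty fm

abbreviation Neg :: "fm \<Rightarrow> fm"  ("\<^bold>\<not> _" [40] 40) where
  "\<^bold>\<not> \<phi> \<equiv> \<phi> \<^bold>\<longrightarrow> \<^bold>\<bottom>"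

text \<open>The list \<open>\<Delta>\<close> gives the types of the dangling de Bruijn indices.\<close>

primrec has_type :: "ty list \<Rightarrow> tm \<Rightarrow> ty \<Rightarrow> bool" where
  "has_type \<Delta> (Free x \<sigma>) \<tau> \<longleftrightarrow> \<tau> = \<sigma>"
| "has_type \<Delta> (Bound i) \<tau> \<longleftrightarrow> i < length \<Delta> \<and> \<tau> = \<Delta> ! i"
| "has_type \<Delta> (Con c) \<tau> \<longleftrightarrow> \<tau> = con_type c"
| "has_type \<Delta> (t \<cdot> s) \<tau> \<longleftrightarrow> (\<exists>\<sigma>. has_type \<Delta> t (\<sigma> \<^bold>\<Rightarrow> \<tau>) \<and> has_type \<Delta> s \<sigma>)"

primrec wf_fm :: "ty list \<Rightarrow> fm \<Rightarrow> bool" where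
  "wf_fm \<Delta> (t \<^bold>= s) \<longleftrightarrow> (\<exists>\<sigma>. has_type \<Delta> t \<sigma> \<and> has_type \<Delta> s \<sigma>)"
| "wf_fm \<Delta> \<^bold>\<bottom> \<longleftrightarrow> True"
| "wf_fm \<Delta> (\<phi> \<^bold>\<and> \<psi>) \<longleftrightarrow> wf_fm \<Delta> \<phi> \<and> wf_fm \<Delta> \<psi>"
| "wf_fm \<Delta> (\<phi> \<^bold>\<or> \<psi>) \<longleftrightarrow> wf_fm \<Delta> \<phi> \<and> wf_fm \<Delta> \<psi>"
| "wf_fm \<Delta> (\<phi> \<^bold>\<longrightarrow> \<psi>) \<longleftrightarrow> wf_fm \<Delta> \<phi> \<and> wf_fm \<Delta> \<psi>"
| "wf_fm \<Delta> (All \<sigma> \<phi>) \<longleftrightarrow> wf_fm (\<sigma> # \<Delta>) \<phi>"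
| "wf_fm \<Delta> (Ex \<sigma> \<phi>) \<longleftrightarrow> wf_fm (\<sigma> # \<Delta>) \<phi>"

primrec fv_tm :: "tm \<Rightarrow> (nat \<times> ty) set" where
  "fv_tm (Free x \<sigma>) = {(x, \<sigma>)}"
| "fv_tm (Bound i) = {}"
| "fv_tm (Con c) = {}"
| "fv_tm (t \<cdot> s) = fv_tm t \<union> fv_tm s"

primrec fv :: "fm \<Rightarrow> (nat \<times> ty) set" where
  "fv (t \<^bold>= s) = fv_tm t \<union> fv_tm s"
| "fv \<^bold>\<bottom> = {}"
| "fv (\<phi> \<^bold>\<and> \<psi>) = fv \<phi> \<union> fv \<psi>"
| "fv (\<phi> \<^bold>\<or> \<psi>) = fv \<phi> \<union> fv \<psi>"
| "fv (\<phi> \<^bold>\<longrightarrow> \<psi>) = fv \<phi> \<union> fv \<psi>"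
| "fv (All \<sigma> \<phi>) = fv \<phi>"
| "fv (Ex \<sigma> \<phi>) = fv \<phi>"

primrec subst_tm :: "(nat \<Rightarrow> tm) \<Rightarrow> tm \<Rightarrow> tm" where
  "subst_tm f (Free x \<sigma>) = Free x \<sigma>"
| "subst_tm f (Bound i) = f i"
| "subst_tm f (Con c) = Con c"
| "subst_tm f (t \<cdot> s) = subst_tm f t \<cdot> subst_tm f s"

definition lift :: "tm \<Rightarrow> tm" where
  "lift = subst_tm (\<lambda>i. Bound (Suc i))"

definition under :: "(nat \<Rightarrow> tm) \<Rightarrow> nat \<Rightarrow> tm" where
  "under f i = (case i of 0 \<Rightarrow> Bound 0 | Suc j \<Rightarrow> lift (f j))"

primrec subst :: "(nat \<Rightarrow> tm) \<Rightarrow> fm \<Rightarrow> fm" where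
  "subst f (t \<^bold>= s) = (subst_tm f t \<^bold>= subst_tm f s)"
| "subst f \<^bold>\<bottom> = \<^bold>\<bottom>"
| "subst f (\<phi> \<^bold>\<and> \<psi>) = (subst f \<phi> \<^bold>\<and> subst f \<psi>)"
| "subst f (\<phi> \<^bold>\<or> \<psi>) = (subst f \<phi> \<^bold>\<or> subst f \<psi>)"
| "subst f (\<phi> \<^bold>\<longrightarrow> \<psi>) = (subst f \<phi> \<^bold>\<longrightarrow> subst f \<psi>)"
| "subst f (All \<sigma> \<phi>) = All \<sigma> (subst (under f) \<phi>)"
| "subst f (Ex \<sigma> \<phi>) = Ex \<sigma> (subst (under f) \<phi>)"

text \<open>
  \<open>inst [t\<^sub>0, \<dots>, t\<^sub>k] \<phi>\<close> replaces the dangling indices \<open>0, \<dots>, k\<close> of \<open>\<phi>\<close> by \<open>t\<^sub>0, \<dots>, t\<^sub>k\<close>; the terms may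
  themselves contain indices bound outside of \<open>\<phi>\<close>.
\<close>

definition inst :: "tm list \<Rightarrow> fm \<Rightarrow> fm" where
  "inst ts = subst (\<lambda>i. if i < length ts then ts ! i else Bound (i - length ts))"


text \<open>
  Equality is primitive at every type and satisfies Leibniz's law (the neutral variant of the
  theory: neither extensionality nor choice is assumed).
\<close>

inductive PA_axiom :: "fm \<Rightarrow> bool" where
  eq_refl: "has_type [] t \<sigma> \<Longrightarrow> PA_axiom (t \<^bold>= t)"
| eq_subst: "has_type [] t \<sigma> \<Longrightarrow> has_type [] s \<sigma> \<Longrightarrow> wf_fm [\<sigma>] \<phi> \<Longrightarrow>
    PA_axiom (t \<^bold>= s \<^bold>\<longrightarrow> inst [t] \<phi> \<^bold>\<longrightarrow> inst [s] \<phi>)"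
| K_conv: "has_type [] t \<sigma> \<Longrightarrow> has_type [] s \<tau> \<Longrightarrow>
    PA_axiom (Con (CK \<sigma> \<tau>) \<cdot> t \<cdot> s \<^bold>= t)"
| S_conv: "has_type [] t (\<sigma> \<^bold>\<Rightarrow> \<tau> \<^bold>\<Rightarrow> \<upsilon>) \<Longrightarrow> has_type [] s (\<sigma> \<^bold>\<Rightarrow> \<tau>) \<Longrightarrow> has_type [] r \<sigma> \<Longrightarrow>
    PA_axiom (Con (CS \<sigma> \<tau> \<upsilon>) \<cdot> t \<cdot> s \<cdot> r \<^bold>= t \<cdot> r \<cdot> (s \<cdot> r))"
| suc_zero: "has_type [] t TNat \<Longrightarrow> PA_axiom (\<^bold>\<not> (suc t \<^bold>= zero))"
| suc_inject: "has_type [] t TNat \<Longrightarrow> has_type [] s TNat \<Longrightarrow>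
    PA_axiom (suc t \<^bold>= suc s \<^bold>\<longrightarrow> t \<^bold>= s)"
| nat_induct: "wf_fm [TNat] \<phi> \<Longrightarrow>
    PA_axiom (inst [zero] \<phi> \<^bold>\<and> All TNat (\<phi> \<^bold>\<longrightarrow> inst [suc (Bound 0)] \<phi>) \<^bold>\<longrightarrow> All TNat \<phi>)"
| rec_zero: "has_type [] b \<sigma> \<Longrightarrow> has_type [] f (TNat \<^bold>\<Rightarrow> \<sigma> \<^bold>\<Rightarrow> \<sigma>) \<Longrightarrow>
    PA_axiom (Con (CRec \<sigma>) \<cdot> b \<cdot> f \<cdot> zero \<^bold>= b)"
| rec_suc: "has_type [] b \<sigma> \<Longrightarrow> has_type [] f (TNat \<^bold>\<Rightarrow> \<sigma> \<^bold>\<Rightarrow> \<sigma>) \<Longrightarrow> has_type [] t TNat \<Longrightarrow>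
    PA_axiom (Con (CRec \<sigma>) \<cdot> b \<cdot> f \<cdot> suc t \<^bold>= f \<cdot> t \<cdot> (Con (CRec \<sigma>) \<cdot> b \<cdot> f \<cdot> t))"
| true_false: "PA_axiom (\<^bold>\<not> (Con CTrue \<^bold>= Con CFalse))"
| bool_induct: "wf_fm [TBool] \<phi> \<Longrightarrow>
    PA_axiom (inst [Con CTrue] \<phi> \<^bold>\<and> inst [Con CFalse] \<phi> \<^bold>\<longrightarrow> All TBool \<phi>)"
| if_true: "has_type [] t \<sigma> \<Longrightarrow> has_type [] s \<sigma> \<Longrightarrow>
    PA_axiom (Con (CIf \<sigma>) \<cdot> t \<cdot> s \<cdot> Con CTrue \<^bold>= t)"
| if_false: "has_type [] t \<sigma> \<Longrightarrow> has_type [] s \<sigma> \<Longrightarrow>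
    PA_axiom (Con (CIf \<sigma>) \<cdot> t \<cdot> s \<cdot> Con CFalse \<^bold>= s)"
| fst_pair: "has_type [] t \<sigma> \<Longrightarrow> has_type [] s \<tau> \<Longrightarrow>
    PA_axiom (Con (CFst \<sigma> \<tau>) \<cdot> (Con (CPair \<sigma> \<tau>) \<cdot> t \<cdot> s) \<^bold>= t)"
| snd_pair: "has_type [] t \<sigma> \<Longrightarrow> has_type [] s \<tau> \<Longrightarrow>
    PA_axiom (Con (CSnd \<sigma> \<tau>) \<cdot> (Con (CPair \<sigma> \<tau>) \<cdot> t \<cdot> s) \<^bold>= s)"
| pair_surj: "has_type [] t (TProd \<sigma> \<tau>) \<Longrightarrow>
    PA_axiom (Con (CPair \<sigma> \<tau>) \<cdot> (Con (CFst \<sigma> \<tau>) \<cdot> t) \<cdot> (Con (CSnd \<sigma> \<tau>) \<cdot> t) \<^bold>= t)"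
| cons_nil: "has_type [] t \<sigma> \<Longrightarrow> has_type [] s (TSeq \<sigma>) \<Longrightarrow>
    PA_axiom (\<^bold>\<not> (Con (CCons \<sigma>) \<cdot> t \<cdot> s \<^bold>= Con (CNil \<sigma>)))"
| cons_inject: "has_type [] t \<sigma> \<Longrightarrow> has_type [] s (TSeq \<sigma>) \<Longrightarrow>
    has_type [] t' \<sigma> \<Longrightarrow> has_type [] s' (TSeq \<sigma>) \<Longrightarrow>
    PA_axiom (Con (CCons \<sigma>) \<cdot> t \<cdot> s \<^bold>= Con (CCons \<sigma>) \<cdot> t' \<cdot> s' \<^bold>\<longrightarrow> t \<^bold>= t' \<^bold>\<and> s \<^bold>= s')"
| seq_induct: "wf_fm [TSeq \<sigma>] \<phi> \<Longrightarrow>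
    PA_axiom (inst [Con (CNil \<sigma>)] \<phi> \<^bold>\<and>
      All (TSeq \<sigma>) (\<phi> \<^bold>\<longrightarrow> All \<sigma> (inst [Con (CCons \<sigma>) \<cdot> Bound 0 \<cdot> Bound 1] \<phi>))
      \<^bold>\<longrightarrow> All (TSeq \<sigma>) \<phi>)"
| seqrec_nil: "has_type [] b \<tau> \<Longrightarrow> has_type [] f (\<sigma> \<^bold>\<Rightarrow> TSeq \<sigma> \<^bold>\<Rightarrow> \<tau> \<^bold>\<Rightarrow> \<tau>) \<Longrightarrow>
    PA_axiom (Con (CSeqRec \<sigma> \<tau>) \<cdot> b \<cdot> f \<cdot> Con (CNil \<sigma>) \<^bold>= b)"
| seqrec_cons: "has_type [] b \<tau> \<Longrightarrow> has_type [] f (\<sigma> \<^bold>\<Rightarrow> TSeq \<sigma> \<^bold>\<Rightarrow> \<tau> \<^bold>\<Rightarrow> \<tau>) \<Longrightarrow>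
    has_type [] t \<sigma> \<Longrightarrow> has_type [] s (TSeq \<sigma>) \<Longrightarrow>
    PA_axiom (Con (CSeqRec \<sigma> \<tau>) \<cdot> b \<cdot> f \<cdot> (Con (CCons \<sigma>) \<cdot> t \<cdot> s)
      \<^bold>= f \<cdot> t \<cdot> s \<cdot> (Con (CSeqRec \<sigma> \<tau>) \<cdot> b \<cdot> f \<cdot> s))"

text \<open>Classical natural deduction; \<open>(x, \<sigma>)\<close> is the eigenvariable in \<open>AllI\<close> and \<open>ExE\<close>.\<close>

inductive derivable :: "fm set \<Rightarrow> fm \<Rightarrow> bool"  (infix "\<^bold>\<turnstile>" 20) where
  Axiom: "PA_axiom \<phi> \<Longrightarrow> H \<^bold>\<turnstile> \<phi>"
| Assm: "\<phi> \<in> H \<Longrightarrow> wf_fm [] \<phi> \<Longrightarrow> H \<^bold>\<turnstile> \<phi>"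
| Weaken: "H \<^bold>\<turnstile> \<phi> \<Longrightarrow> H \<subseteq> H' \<Longrightarrow> H' \<^bold>\<turnstile> \<phi>"
| Contr: "insert (\<^bold>\<not> \<phi>) H \<^bold>\<turnstile> \<^bold>\<bottom> \<Longrightarrow> wf_fm [] \<phi> \<Longrightarrow> H \<^bold>\<turnstile> \<phi>"
| ImpI: "insert \<phi> H \<^bold>\<turnstile> \<psi> \<Longrightarrow> wf_fm [] \<phi> \<Longrightarrow> H \<^bold>\<turnstile> \<phi> \<^bold>\<longrightarrow> \<psi>"
| ImpE: "H \<^bold>\<turnstile> \<phi> \<^bold>\<longrightarrow> \<psi> \<Longrightarrow> H \<^bold>\<turnstile> \<phi> \<Longrightarrow> H \<^bold>\<turnstile> \<psi>"
| AndI: "H \<^bold>\<turnstile> \<phi> \<Longrightarrow> H \<^bold>\<turnstile> \<psi> \<Longrightarrow> H \<^bold>\<turnstile> \<phi> \<^bold>\<and> \<psi>"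
| AndE1: "H \<^bold>\<turnstile> \<phi> \<^bold>\<and> \<psi> \<Longrightarrow> H \<^bold>\<turnstile> \<phi>"
| AndE2: "H \<^bold>\<turnstile> \<phi> \<^bold>\<and> \<psi> \<Longrightarrow> H \<^bold>\<turnstile> \<psi>"
| OrI1: "H \<^bold>\<turnstile> \<phi> \<Longrightarrow> wf_fm [] \<psi> \<Longrightarrow> H \<^bold>\<turnstile> \<phi> \<^bold>\<or> \<psi>"
| OrI2: "H \<^bold>\<turnstile> \<psi> \<Longrightarrow> wf_fm [] \<phi> \<Longrightarrow> H \<^bold>\<turnstile> \<phi> \<^bold>\<or> \<psi>"
| OrE: "H \<^bold>\<turnstile> \<phi> \<^bold>\<or> \<psi> \<Longrightarrow> insert \<phi> H \<^bold>\<turnstile> \<chi> \<Longrightarrow> insert \<psi> H \<^bold>\<turnstile> \<chi> \<Longrightarrow> H \<^bold>\<turnstile> \<chi>"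
| AllI: "H \<^bold>\<turnstile> inst [Free x \<sigma>] \<phi> \<Longrightarrow> wf_fm [\<sigma>] \<phi> \<Longrightarrow>
    (x, \<sigma>) \<notin> fv \<phi> \<union> \<Union> (fv ` H) \<Longrightarrow> H \<^bold>\<turnstile> All \<sigma> \<phi>"
| AllE: "H \<^bold>\<turnstile> All \<sigma> \<phi> \<Longrightarrow> has_type [] t \<sigma> \<Longrightarrow> H \<^bold>\<turnstile> inst [t] \<phi>"
| ExI: "H \<^bold>\<turnstile> inst [t] \<phi> \<Longrightarrow> has_type [] t \<sigma> \<Longrightarrow> wf_fm [\<sigma>] \<phi> \<Longrightarrow> H \<^bold>\<turnstile> Ex \<sigma> \<phi>"
| ExE: "H \<^bold>\<turnstile> Ex \<sigma> \<phi> \<Longrightarrow> insert (inst [Free x \<sigma>] \<phi>) H \<^bold>\<turnstile> \<psi> \<Longrightarrow>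
    (x, \<sigma>) \<notin> fv \<phi> \<union> fv \<psi> \<union> \<Union> (fv ` H) \<Longrightarrow> H \<^bold>\<turnstile> \<psi>"

definition PA_proves :: "fm \<Rightarrow> bool" where
  "PA_proves \<phi> \<longleftrightarrow> ({} \<^bold>\<turnstile> \<phi>)"


text \<open>
  A relation on \<open>\<rho>\<close> is a formula whose dangling indices \<open>0\<close> and \<open>1\<close> stand for its left and right
  argument; it may contain further free variables as parameters. In what follows \<open>D\<close>, \<open>R\<close>, \<open>R\<^sub>0\<close>
  are the relations \<open>\<rhd>\<close>, \<open>\<succ>\<close>, \<open>\<succ>\<^sub>0\<close>.
\<close>

definition relation_on :: "ty \<Rightarrow> fm \<Rightarrow> bool" where
  "relation_on \<rho> R \<longleftrightarrow> wf_fm [\<rho>, \<rho>] R"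

definition rel :: "fm \<Rightarrow> tm \<Rightarrow> tm \<Rightarrow> fm" where
  "rel R x y = inst [x, y] R"

definition WF :: "fm \<Rightarrow> tm \<Rightarrow> fm" where
  "WF R \<alpha> = Ex TNat (\<^bold>\<not> rel R (lift \<alpha> \<cdot> Bound 0) (lift \<alpha> \<cdot> suc (Bound 0)))"

definition starts :: "tm \<Rightarrow> tm \<Rightarrow> fm" where
  "starts x \<alpha> = (\<alpha> \<cdot> zero \<^bold>= x)"

definition eWF :: "ty \<Rightarrow> fm \<Rightarrow> tm \<Rightarrow> fm" where
  "eWF \<rho> R x = All (TNat \<^bold>\<Rightarrow> \<rho>) (starts (lift x) (Bound 0) \<^bold>\<longrightarrow> WF R (Bound 0))"

text \<open>
  The first conjunct covers the case \<open>n = 0\<close>, where the condition \<open>\<alpha>\<^sub>n\<^sub>-\<^sub>1 \<succ> y\<close> is absent; the second one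
  is the case of a positive index, written as the successor of \<open>n\<close>.
\<close>

definition eMIN :: "ty \<Rightarrow> fm \<Rightarrow> fm \<Rightarrow> tm \<Rightarrow> fm" where
  "eMIN \<rho> D R \<alpha> =
    (All \<rho> (rel D (lift \<alpha> \<cdot> zero) (Bound 0) \<^bold>\<longrightarrow> eWF \<rho> R (Bound 0)) \<^bold>\<and>
     All TNat (All \<rho>
       (rel R (lift (lift \<alpha>) \<cdot> Bound 1) (Bound 0) \<^bold>\<and>
        rel D (lift (lift \<alpha>) \<cdot> suc (Bound 1)) (Bound 0)
        \<^bold>\<longrightarrow> eWF \<rho> R (Bound 0))))"

definition eTP :: "ty \<Rightarrow> fm \<Rightarrow> fm \<Rightarrow> fm" where
  "eTP \<rho> D R =
    (All (TNat \<^bold>\<Rightarrow> \<rho>) (eMIN \<rho> D R (Bound 0) \<^bold>\<longrightarrow> WF R (Bound 0)) \<^bold>\<longrightarrow>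
     All \<rho> (eWF \<rho> R (Bound 0)))"

definition releq :: "fm \<Rightarrow> tm \<Rightarrow> tm \<Rightarrow> fm" where
  "releq R x y = (rel R x y \<^bold>\<or> x \<^bold>= y)"

definition decomposition :: "ty \<Rightarrow> fm \<Rightarrow> fm \<Rightarrow> fm \<Rightarrow> fm" where
  "decomposition \<rho> D R R\<^sub>0 =
    (All \<rho> (All \<rho> (rel R (Bound 1) (Bound 0) \<^bold>\<longrightarrow>
       Ex \<rho> (rel D (Bound 2) (Bound 0) \<^bold>\<and> releq R (Bound 0) (Bound 1)) \<^bold>\<or>
       rel R\<^sub>0 (Bound 1) (Bound 0))) \<^bold>\<and>
     All \<rho> (All \<rho> (rel R\<^sub>0 (Bound 1) (Bound 0) \<^bold>\<longrightarrow>
       All \<rho> (rel D (Bound 1) (Bound 0) \<^bold>\<longrightarrow> rel R (Bound 2) (Bound 0)))))"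

definition subrelation :: "ty \<Rightarrow> fm \<Rightarrow> fm \<Rightarrow> fm" where
  "subrelation \<rho> R\<^sub>0 R =
    All \<rho> (All \<rho> (rel R\<^sub>0 (Bound 1) (Bound 0) \<^bold>\<longrightarrow> rel R (Bound 1) (Bound 0)))"

definition accA :: "ty \<Rightarrow> fm \<Rightarrow> fm \<Rightarrow> tm \<Rightarrow> fm" where
  "accA \<rho> D R x = All \<rho> (rel D (lift x) (Bound 0) \<^bold>\<longrightarrow> eWF \<rho> R (Bound 0))"

definition eWFA :: "ty \<Rightarrow> fm \<Rightarrow> fm \<Rightarrow> fm \<Rightarrow> tm \<Rightarrow> fm" where
  "eWFA \<rho> D R R\<^sub>0 x =
    All (TNat \<^bold>\<Rightarrow> \<rho>)
      (All TNat (accA \<rho> D R (Bound 1 \<cdot> Bound 0)) \<^bold>\<and> starts (lift x) (Bound 0)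
       \<^bold>\<longrightarrow> Ex TNat (\<^bold>\<not> rel R\<^sub>0 (Bound 1 \<cdot> Bound 0) (Bound 1 \<cdot> suc (Bound 0))))"

definition sTP :: "ty \<Rightarrow> fm \<Rightarrow> fm \<Rightarrow> fm \<Rightarrow> fm" where
  "sTP \<rho> D R R\<^sub>0 =
    (All \<rho> (eWFA \<rho> D R R\<^sub>0 (Bound 0)) \<^bold>\<longrightarrow> All \<rho> (eWF \<rho> R (Bound 0)))"

end

theory Submission
  imports Defs "HOL-Library.Countable"
begin

text \<open>
  Every consistent formula belongs to a complete theory with Henkin witnesses, and membership in such
  a theory commutes with all connectives and with quantification over closed terms. Hence a formula
  is derivable as soon as it holds in all Henkin theories, and inside one of them the argument is the
  informal one.

  First claim: let \<open>\<alpha>\<close> be a minimal sequence with \<open>\<alpha>\<^sub>n \<succ> \<alpha>\<^sub>n\<^sub>+\<^sub>1\<close> for all \<open>n\<close>. By induction \<open>A(\<alpha>\<^sub>n)\<close>: given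
  \<open>A(\<alpha>\<^sub>n)\<close>, an element \<open>u\<close> with \<open>\<alpha>\<^sub>n \<rhd> u \<succeq> \<alpha>\<^sub>n\<^sub>+\<^sub>1\<close> would be well-founded, yet it starts the descending
  sequence \<open>u, \<alpha>\<^sub>n\<^sub>+\<^sub>1, \<alpha>\<^sub>n\<^sub>+\<^sub>2, \<dots>\<close> (or this sequence without \<open>u\<close>). So \<open>\<alpha>\<^sub>n \<succ>\<^sub>0 \<alpha>\<^sub>n\<^sub>+\<^sub>1\<close>, every \<open>y\<close> with
  \<open>\<alpha>\<^sub>n\<^sub>+\<^sub>1 \<rhd> y\<close> satisfies \<open>\<alpha>\<^sub>n \<succ> y\<close>, and minimality gives \<open>A(\<alpha>\<^sub>n\<^sub>+\<^sub>1)\<close>. Thus \<open>\<alpha>\<close> is \<open>\<succ>\<^sub>0\<close>-descending inside \<open>A\<close>,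
  against the premise of \<open>sTP\<close>. Second claim: a \<open>\<succ>\<^sub>0\<close>-descending sequence inside \<open>A\<close> is minimal and
  \<open>\<succ>\<close>-descending.
\<close>

section \<open>Substitution and typing\<close>

lemma under_simps [simp]: "under f 0 = Bound 0" "under f (Suc i) = lift (f i)"
  by (simp_all add: under_def)

lemma lift_Bound [simp]: "lift (Bound i) = Bound (Suc i)"
  by (simp add: lift_def)

lemma subst_tm_subst_tm: "subst_tm f (subst_tm g t) = subst_tm (\<lambda>i. subst_tm f (g i)) t"
  by (induction t) auto

lemma subst_tm_under_lift: "subst_tm (under f) (lift t) = lift (subst_tm f t)"
  by (simp add: lift_def subst_tm_subst_tm under_def)

text \<open>Moving under a binder respects composition of substitutions. This is the quantifier case
  of \<open>subst_subst\<close>.\<close>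

lemma under_comp: "(\<lambda>i. subst_tm (under f) (under g i)) = under (\<lambda>i. subst_tm f (g i))"
proof
  fix i show "subst_tm (under f) (under g i) = under (\<lambda>i. subst_tm f (g i)) i"
    by (cases i) (simp_all add: subst_tm_under_lift)
qed

lemma subst_subst: "subst f (subst g \<phi>) = subst (\<lambda>i. subst_tm f (g i)) \<phi>"
  by (induction \<phi> arbitrary: f g) (simp_all add: subst_tm_subst_tm under_comp)

lemma subst_tm_cong:
  "has_type \<Delta> t \<tau> \<Longrightarrow> (\<And>i. i < length \<Delta> \<Longrightarrow> f i = g i) \<Longrightarrow> subst_tm f t = subst_tm g t"
  by (induction t arbitrary: \<tau>) auto

lemma under_cong: "(\<And>i. i < n \<Longrightarrow> f i = g i) \<Longrightarrow> i < Suc n \<Longrightarrow> under f i = under g i"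
  by (cases i) auto

lemma subst_cong:
  "wf_fm \<Delta> \<phi> \<Longrightarrow> (\<And>i. i < length \<Delta> \<Longrightarrow> f i = g i) \<Longrightarrow> subst f \<phi> = subst g \<phi>"
proof (induction \<phi> arbitrary: \<Delta> f g)
  case (Eq t s)
  then obtain \<sigma> where "has_type \<Delta> t \<sigma>" "has_type \<Delta> s \<sigma>" by auto
  then show ?case using subst_tm_cong[OF _ Eq.prems(2)] by simp
next
  case (All \<sigma> \<phi>)
  have "subst (under f) \<phi> = subst (under g) \<phi>"
    using All.prems by (intro All.IH[of "\<sigma> # \<Delta>"]) (auto intro: under_cong)
  then show ?case by simp
next
  case (Ex \<sigma> \<phi>)
  have "subst (under f) \<phi> = subst (under g) \<phi>"
    using Ex.prems by (intro Ex.IH[of "\<sigma> # \<Delta>"]) (auto intro: under_cong)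
  then show ?case by simp
next
  case (And \<phi> \<psi>)
  then show ?case using And.IH[of \<Delta> f g] by simp
next
  case (Or \<phi> \<psi>)
  then show ?case using Or.IH[of \<Delta> f g] by simp
next
  case (Imp \<phi> \<psi>)
  then show ?case using Imp.IH[of \<Delta> f g] by simp
qed simp_all

lemma subst_tm_Bound: "subst_tm Bound t = t"
  by (induction t) auto

lemma subst_tm_closed: "has_type [] t \<tau> \<Longrightarrow> subst_tm f t = t"
  using subst_tm_cong[of "[]" t \<tau> f Bound] by (simp add: subst_tm_Bound)

lemma lift_closed: "has_type [] t \<tau> \<Longrightarrow> lift t = t"
  by (simp add: lift_def subst_tm_closed)

text \<open>\<open>inst\<close> lowers indices beyond \<open>ts\<close>, which would break this law
  in general. A formula that is well-formed in a context as long as \<open>ts\<close> has no such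
  index, so \<open>subst_cong\<close> only compares the two substitutions on the indices replaced by
  \<open>ts\<close>.\<close>

lemma subst_inst:
  assumes "wf_fm \<Delta> \<phi>" and "length ts = length \<Delta>"
  shows "subst f (inst ts \<phi>) = inst (map (subst_tm f) ts) \<phi>"
  unfolding inst_def subst_subst using assms by (intro subst_cong) auto

lemma has_type_subst_tm:
  "has_type \<Delta> t \<tau> \<Longrightarrow> (\<And>i. i < length \<Delta> \<Longrightarrow> has_type \<Delta>' (f i) (\<Delta> ! i)) \<Longrightarrow>
    has_type \<Delta>' (subst_tm f t) \<tau>"
  by (induction t arbitrary: \<tau>) fastforce+

lemma has_type_lift: "has_type \<Delta> t \<tau> \<Longrightarrow> has_type (\<sigma> # \<Delta>) (lift t) \<tau>"
  unfolding lift_def by (erule has_type_subst_tm) simp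

lemma has_type_weaken: "has_type [] t \<tau> \<Longrightarrow> has_type \<Delta> t \<tau>"
  using has_type_subst_tm[of "[]" t \<tau> \<Delta> Bound] by (simp add: subst_tm_Bound)

lemma wf_fm_subst:
  "wf_fm \<Delta> \<phi> \<Longrightarrow> (\<And>i. i < length \<Delta> \<Longrightarrow> has_type \<Delta>' (f i) (\<Delta> ! i)) \<Longrightarrow> wf_fm \<Delta>' (subst f \<phi>)"
proof (induction \<phi> arbitrary: \<Delta> \<Delta>' f)
  case (Eq t s)
  then obtain \<sigma> where "has_type \<Delta> t \<sigma>" "has_type \<Delta> s \<sigma>" by auto
  then show ?case using has_type_subst_tm[OF _ Eq.prems(2)] by auto
next
  case (All \<sigma> \<phi>)
  have "has_type (\<sigma> # \<Delta>') (under f i) ((\<sigma> # \<Delta>) ! i)" if "i < length (\<sigma> # \<Delta>)" for i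
    using that All.prems(2) by (cases i) (auto intro: has_type_lift)
  then show ?case using All.IH[of "\<sigma> # \<Delta>"] All.prems(1) by simp
next
  case (Ex \<sigma> \<phi>)
  have "has_type (\<sigma> # \<Delta>') (under f i) ((\<sigma> # \<Delta>) ! i)" if "i < length (\<sigma> # \<Delta>)" for i
    using that Ex.prems(2) by (cases i) (auto intro: has_type_lift)
  then show ?case using Ex.IH[of "\<sigma> # \<Delta>"] Ex.prems(1) by simp
next
  case (And \<phi> \<psi>)
  then show ?case using And.IH[of \<Delta> \<Delta>' f] by simp
next
  case (Or \<phi> \<psi>)
  then show ?case using Or.IH[of \<Delta> \<Delta>' f] by simp
next
  case (Imp \<phi> \<psi>)
  then show ?case using Imp.IH[of \<Delta> \<Delta>' f] by simp
qed simp_all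

lemma wf_fm_inst1:
  "wf_fm [\<sigma>] \<phi> \<Longrightarrow> has_type \<Delta> t \<sigma> \<Longrightarrow> wf_fm \<Delta> (inst [t] \<phi>)"
  unfolding inst_def by (erule wf_fm_subst) simp

text \<open>The induction axiom states its step with \<open>suc (Bound 0)\<close> under a
  quantifier. Instantiating that quantifier by \<open>t\<close> yields the expected successor
  instance.\<close>

lemma inst_inst_suc:
  "wf_fm [TNat] \<phi> \<Longrightarrow> inst [t] (inst [suc (Bound 0)] \<phi>) = inst [suc t] \<phi>"
  using subst_inst[of "[TNat]" \<phi> "[suc (Bound 0)]"] by (subst inst_def) simp

lemma has_type_unique: "has_type \<Delta> t \<sigma> \<Longrightarrow> has_type \<Delta> t \<tau> \<Longrightarrow> \<sigma> = \<tau>"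
  by (induction t arbitrary: \<sigma> \<tau>) auto

lemma has_type_closed_iff: "has_type [] t \<sigma> \<Longrightarrow> has_type \<Delta> t \<tau> \<longleftrightarrow> \<tau> = \<sigma>"
  using has_type_unique has_type_weaken by blast

text \<open>Applied to a typing of a closed term, these rules erase substitutions and liftings of
  that term and turn each typing claim about it into an equation of types.\<close>

lemmas closed_simps = subst_tm_closed lift_closed has_type_closed_iff

lemma finite_fv: "finite (fv \<phi>)"
proof -
  have "finite (fv_tm t)" for t by (induction t) auto
  then show ?thesis by (induction \<phi>) auto
qed

lemma fresh_variable:
  assumes "finite H"
  obtains x where "(x, \<sigma>) \<notin> \<Union> (fv ` H)"
proof -
  have "finite (fst ` \<Union> (fv ` H))" using assms finite_fv by auto
  then obtain x where "x \<notin> fst ` \<Union> (fv ` H)" using ex_new_if_finite infinite_UNIV_nat by blast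
  then show thesis using that by (metis fst_conv image_eqI)
qed

section \<open>Henkin theories\<close>

instance ty :: countable by countable_datatype
instance con :: countable by countable_datatype
instance tm :: countable by countable_datatype
instance fm :: countable by countable_datatype

text \<open>The members of \<open>H\<close> are discharged one at a time by \<open>ImpI\<close> and
  paid for by \<open>ImpE\<close>. Each discharge changes the goal into an implication, hence the
  general \<phi> in the induction.\<close>

lemma derivable_cut:
  assumes "finite H" and "\<And>\<psi>. \<psi> \<in> H \<Longrightarrow> wf_fm [] \<psi> \<and> (G \<^bold>\<turnstile> \<psi>)" and "H \<^bold>\<turnstile> \<phi>"
  shows "G \<^bold>\<turnstile> \<phi>"
  using assms
proof (induction H arbitrary: \<phi> rule: finite_induct)
  case empty
  then show ?case using Weaken by blast
next
  case (insert \<psi> H)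
  have "H \<^bold>\<turnstile> \<psi> \<^bold>\<longrightarrow> \<phi>" using insert.prems by (blast intro: ImpI)
  then have "G \<^bold>\<turnstile> \<psi> \<^bold>\<longrightarrow> \<phi>" using insert by blast
  then show ?case using insert.prems ImpE by blast
qed

lemma explosion: "H \<^bold>\<turnstile> \<^bold>\<bottom> \<Longrightarrow> wf_fm [] \<phi> \<Longrightarrow> H \<^bold>\<turnstile> \<phi>"
  by (blast intro: Contr Weaken)

lemma Assm_insert: "wf_fm [] \<phi> \<Longrightarrow> insert \<phi> H \<^bold>\<turnstile> \<phi>"
  by (blast intro: Assm)

text \<open>If there is no counterexample, then the instance at a fresh variable holds by
  contradiction, and \<open>AllI\<close> generalises it. Henkin witnesses are only available for
  \<open>Ex\<close>; this law carries them over to failing universal formulas.\<close>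

lemma not_All_derives_Ex_not:
  assumes wf: "wf_fm [\<sigma>] \<phi>"
  shows "{\<^bold>\<not> All \<sigma> \<phi>} \<^bold>\<turnstile> Ex \<sigma> (\<^bold>\<not> \<phi>)"
proof (rule Contr)
  let ?E = "Ex \<sigma> (\<^bold>\<not> \<phi>)"
  let ?H = "{\<^bold>\<not> ?E, \<^bold>\<not> All \<sigma> \<phi>}"
  show "wf_fm [] ?E" using wf by simp
  obtain x where x: "(x, \<sigma>) \<notin> \<Union> (fv ` {\<phi>})" by (rule fresh_variable[of "{\<phi>}"]) simp
  let ?i = "inst [Free x \<sigma>] \<phi>"
  have wfi: "wf_fm [] ?i" using wf by (rule wf_fm_inst1) simp
  have "insert (\<^bold>\<not> ?i) ?H \<^bold>\<turnstile> inst [Free x \<sigma>] (\<^bold>\<not> \<phi>)"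
    using Assm_insert wfi by (simp add: inst_def)
  then have "insert (\<^bold>\<not> ?i) ?H \<^bold>\<turnstile> ?E" by (rule ExI) (use wf in simp_all)
  moreover have "insert (\<^bold>\<not> ?i) ?H \<^bold>\<turnstile> \<^bold>\<not> ?E" by (rule Assm) (use wf in simp_all)
  ultimately have "insert (\<^bold>\<not> ?i) ?H \<^bold>\<turnstile> \<^bold>\<bottom>" using ImpE by blast
  then have "?H \<^bold>\<turnstile> ?i" using wfi by (rule Contr)
  then have "?H \<^bold>\<turnstile> All \<sigma> \<phi>" by (rule AllI) (use wf x in simp_all)
  moreover have "?H \<^bold>\<turnstile> \<^bold>\<not> All \<sigma> \<phi>" by (rule Assm) (use wf in simp_all)
  ultimately show "?H \<^bold>\<turnstile> \<^bold>\<bottom>" using ImpE by blast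
qed

text \<open>Closed means without dangling indices: \<open>Free\<close> variables are still allowed.
  They play the part of Henkin constants, so the language need not be extended.\<close>

locale henkin_theory =
  fixes T :: "fm \<Rightarrow> bool"
  assumes deductive: "finite H \<Longrightarrow> (\<And>\<psi>. \<psi> \<in> H \<Longrightarrow> wf_fm [] \<psi> \<and> T \<psi>) \<Longrightarrow> H \<^bold>\<turnstile> \<phi> \<Longrightarrow> T \<phi>"
    and consistent: "\<not> T \<^bold>\<bottom>"
    and complete: "wf_fm [] \<phi> \<Longrightarrow> T \<phi> \<or> T (\<^bold>\<not> \<phi>)"
    and witness: "wf_fm [\<sigma>] \<phi> \<Longrightarrow> T (Ex \<sigma> \<phi>) \<Longrightarrow> \<exists>t. has_type [] t \<sigma> \<and> T (inst [t] \<phi>)"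

section \<open>Construction of complete theories with witnesses\<close>

definition decides :: "fm set \<Rightarrow> fm \<Rightarrow> bool" where
  "decides G \<psi> \<longleftrightarrow> ((G \<^bold>\<turnstile> \<psi>) \<or> (G \<^bold>\<turnstile> \<^bold>\<not> \<psi>)) \<and>
    (\<forall>\<sigma> \<chi>. \<psi> = Ex \<sigma> \<chi> \<and> (G \<^bold>\<turnstile> \<psi>) \<longrightarrow> (\<exists>t. has_type [] t \<sigma> \<and> (G \<^bold>\<turnstile> inst [t] \<chi>)))"

text \<open>Either \<open>G\<close> already refutes \<psi>, or \<psi> can be added consistently. If
  \<psi> is existential, its instance at a fresh variable is added too, and \<open>ExE\<close> shows
  that this creates no contradiction.\<close>

lemma extend_to_decide:
  assumes fin: "finite G" and con: "\<not> (G \<^bold>\<turnstile> \<^bold>\<bottom>)" and wf: "wf_fm [] \<psi>"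
  shows "\<exists>G'. G \<subseteq> G' \<and> finite G' \<and> \<not> (G' \<^bold>\<turnstile> \<^bold>\<bottom>) \<and> decides G' \<psi>"
proof (cases "insert \<psi> G \<^bold>\<turnstile> \<^bold>\<bottom>")
  case True
  then have "G \<^bold>\<turnstile> \<^bold>\<not> \<psi>" using wf ImpI by blast
  moreover from this have "\<not> (G \<^bold>\<turnstile> \<psi>)" using con ImpE by blast
  ultimately show ?thesis using fin con unfolding decides_def by blast
next
  case False
  show ?thesis
  proof (cases "\<exists>\<sigma> \<chi>. \<psi> = Ex \<sigma> \<chi>")
    case True
    then obtain \<sigma> \<chi> where \<psi>: "\<psi> = Ex \<sigma> \<chi>" by blast
    obtain x where x: "(x, \<sigma>) \<notin> \<Union> (fv ` insert \<chi> (insert \<psi> G))"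
      by (rule fresh_variable[of "insert \<chi> (insert \<psi> G)"]) (use fin in simp)
    let ?i = "inst [Free x \<sigma>] \<chi>"
    let ?G = "insert ?i (insert \<psi> G)"
    have "wf_fm [] ?i" using wf \<psi> by (intro wf_fm_inst1) simp_all
    then have i: "?G \<^bold>\<turnstile> ?i" by (rule Assm_insert)
    have "insert \<psi> G \<^bold>\<turnstile> Ex \<sigma> \<chi>" using wf \<psi> Assm_insert by blast
    then have "\<not> (?G \<^bold>\<turnstile> \<^bold>\<bottom>)" using False x ExE[of "insert \<psi> G" \<sigma> \<chi> x "\<^bold>\<bottom>"] by auto
    moreover have "?G \<^bold>\<turnstile> \<psi>" using wf by (intro Assm) simp_all
    moreover have "has_type [] (Free x \<sigma>) \<sigma>" by simp
    ultimately show ?thesis using i fin \<psi> unfolding decides_def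
      by (intro exI[of _ ?G]) blast
  next
    case False': False
    have "insert \<psi> G \<^bold>\<turnstile> \<psi>" using wf by (rule Assm_insert)
    then show ?thesis using False False' fin unfolding decides_def
      by (intro exI[of _ "insert \<psi> G"]) blast
  qed
qed

lemma henkin_theory_exists:
  assumes fin: "finite H" and con: "\<not> (H \<^bold>\<turnstile> \<^bold>\<bottom>)"
  shows "\<exists>T. henkin_theory T \<and> (\<forall>\<psi>. (H \<^bold>\<turnstile> \<psi>) \<longrightarrow> T \<psi>)"
proof -
  let ?P = "\<lambda>G. finite G \<and> \<not> (G \<^bold>\<turnstile> \<^bold>\<bottom>) \<and> H \<subseteq> G"
  \<comment> \<open>The stage after \<open>n\<close> decides the formula with code \<open>n\<close>
    if that formula is well-formed. All stages stay finite, so fresh variables remain for later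
    witnesses.\<close>
  let ?Q = "\<lambda>n G G'. G \<subseteq> G' \<and> (wf_fm [] (from_nat n) \<longrightarrow> decides G' (from_nat n))"
  have "\<exists>\<Gamma>. \<forall>n. ?P (\<Gamma> n) \<and> ?Q n (\<Gamma> n) (\<Gamma> (Suc n))"
  proof (rule dependent_nat_choice)
    show "\<exists>G. ?P G" using assms by blast
    show "\<exists>G'. ?P G' \<and> ?Q n G G'" if "?P G" for G n
      using extend_to_decide[of G "from_nat n"] that by blast
  qed
  then obtain \<Gamma> where P: "\<And>n. ?P (\<Gamma> n)" and Q: "\<And>n. ?Q n (\<Gamma> n) (\<Gamma> (Suc n))" by blast
  have mono: "\<Gamma> m \<subseteq> \<Gamma> n" if "m \<le> n" for m n
    using Q by (intro lift_Suc_mono_le[OF _ that]) blast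
  have up: "(\<Gamma> m \<^bold>\<turnstile> \<phi>) \<Longrightarrow> m \<le> n \<Longrightarrow> \<Gamma> n \<^bold>\<turnstile> \<phi>" for m n \<phi>
    using mono Weaken by blast
  have dec: "\<exists>n. decides (\<Gamma> n) \<phi>" if "wf_fm [] \<phi>" for \<phi>
    using Q[of "to_nat \<phi>"] that by auto
  define T where "T \<phi> \<longleftrightarrow> (\<exists>n. \<Gamma> n \<^bold>\<turnstile> \<phi>)" for \<phi>
  have "henkin_theory T"
  proof
    fix G \<phi> assume "finite G" and G: "\<And>\<psi>. \<psi> \<in> G \<Longrightarrow> wf_fm [] \<psi> \<and> T \<psi>" and "G \<^bold>\<turnstile> \<phi>"
    obtain m where m: "\<And>\<psi>. \<psi> \<in> G \<Longrightarrow> \<Gamma> (m \<psi>) \<^bold>\<turnstile> \<psi>" using G unfolding T_def by metis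
    \<comment> \<open>A single stage derives all members of the finite set \<open>G\<close>. For
      empty \<open>G\<close> the value of \<open>Max\<close> is unspecified, but then any stage will
      do.\<close>
    have "\<Gamma> (Max (m ` G)) \<^bold>\<turnstile> \<psi>" if "\<psi> \<in> G" for \<psi>
      using up[OF m[OF that]] \<open>finite G\<close> that by simp
    then show "T \<phi>" using derivable_cut[OF \<open>finite G\<close> _ \<open>G \<^bold>\<turnstile> \<phi>\<close>] G unfolding T_def by blast
  next
    show "\<not> T \<^bold>\<bottom>" using P unfolding T_def by blast
  next
    fix \<phi> assume "wf_fm [] \<phi>"
    then show "T \<phi> \<or> T (\<^bold>\<not> \<phi>)" using dec unfolding T_def decides_def by blast
  next
    fix \<sigma> \<phi> assume "wf_fm [\<sigma>] \<phi>" and "T (Ex \<sigma> \<phi>)"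
    then obtain m n where m: "\<Gamma> m \<^bold>\<turnstile> Ex \<sigma> \<phi>" and n: "decides (\<Gamma> n) (Ex \<sigma> \<phi>)"
      using dec[of "Ex \<sigma> \<phi>"] unfolding T_def by auto
    \<comment> \<open>Stage \<open>n\<close> supplies a witness only if it derives the existential
      formula itself, which is known for stage \<open>m\<close>. Since stage \<open>n\<close>
      decides the formula, it suffices that it does not refute it, and a refutation would make stage
      \<open>max m n\<close> inconsistent.\<close>
    have "\<not> (\<Gamma> n \<^bold>\<turnstile> \<^bold>\<not> Ex \<sigma> \<phi>)"
    proof
      assume "\<Gamma> n \<^bold>\<turnstile> \<^bold>\<not> Ex \<sigma> \<phi>"
      then have "\<Gamma> (max m n) \<^bold>\<turnstile> \<^bold>\<bottom>" using ImpE up[OF _ max.cobounded2] up[OF m max.cobounded1] by blast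
      then show False using P by blast
    qed
    then show "\<exists>t. has_type [] t \<sigma> \<and> T (inst [t] \<phi>)"
      using n unfolding decides_def T_def by blast
  qed
  moreover have "T \<psi>" if "H \<^bold>\<turnstile> \<psi>" for \<psi>
    using that P[of 0] Weaken unfolding T_def by blast
  ultimately show ?thesis by blast
qed

text \<open>If \<phi> were unprovable, its negation would be consistent by \<open>Contr\<close>, and
  some Henkin theory would contain both \<phi> and its negation.\<close>

theorem PA_proves_if_true_in_henkin_theories:
  assumes wf: "wf_fm [] \<phi>" and true: "\<And>T. henkin_theory T \<Longrightarrow> T \<phi>"
  shows "PA_proves \<phi>"
proof (rule ccontr)
  assume "\<not> PA_proves \<phi>"
  then have "\<not> ({\<^bold>\<not> \<phi>} \<^bold>\<turnstile> \<^bold>\<bottom>)" using wf Contr unfolding PA_proves_def by blast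
  then obtain T where T: "henkin_theory T" and "\<forall>\<psi>. ({\<^bold>\<not> \<phi>} \<^bold>\<turnstile> \<psi>) \<longrightarrow> T \<psi>"
    using henkin_theory_exists[of "{\<^bold>\<not> \<phi>}"] by blast
  moreover have "{\<^bold>\<not> \<phi>} \<^bold>\<turnstile> \<^bold>\<not> \<phi>" using wf by (intro Assm) simp_all
  ultimately have neg: "T (\<^bold>\<not> \<phi>)" by blast
  interpret henkin_theory T by fact
  have "{\<phi>, \<^bold>\<not> \<phi>} \<^bold>\<turnstile> \<^bold>\<bottom>" by (rule ImpE[of _ \<phi>]; rule Assm) (use wf in simp_all)
  then have "T \<^bold>\<bottom>" by (rule deductive[rotated 2]) (use wf neg true[OF T] in auto)
  then show False using consistent by blast
qed

section \<open>Membership in a Henkin theory: connectives, quantifiers, induction\<close>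

context henkin_theory
begin

lemma true_axiom: "PA_axiom \<phi> \<Longrightarrow> T \<phi>"
  using deductive[of "{}"] Axiom by blast

lemma true_derivable1:
  "T \<psi> \<Longrightarrow> wf_fm [] \<psi> \<Longrightarrow> {\<psi>} \<^bold>\<turnstile> \<phi> \<Longrightarrow> T \<phi>"
  using deductive[of "{\<psi>}"] by blast

lemma true_derivable2:
  "T \<psi> \<Longrightarrow> wf_fm [] \<psi> \<Longrightarrow> T \<chi> \<Longrightarrow> wf_fm [] \<chi> \<Longrightarrow> {\<psi>, \<chi>} \<^bold>\<turnstile> \<phi> \<Longrightarrow> T \<phi>"
  using deductive[of "{\<psi>, \<chi>}"] by blast

lemma true_mp: "T (\<phi> \<^bold>\<longrightarrow> \<psi>) \<Longrightarrow> T \<phi> \<Longrightarrow> wf_fm [] \<phi> \<Longrightarrow> wf_fm [] \<psi> \<Longrightarrow> T \<psi>"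
  by (erule true_derivable2[of "\<phi> \<^bold>\<longrightarrow> \<psi>" \<phi>], simp_all, rule ImpE[of _ \<phi>]; rule Assm) simp_all

lemma true_Neg: "wf_fm [] \<phi> \<Longrightarrow> T (\<^bold>\<not> \<phi>) \<longleftrightarrow> \<not> T \<phi>"
  using complete consistent true_mp[of \<phi> "\<^bold>\<bottom>"] by auto

lemma true_Imp:
  assumes "wf_fm [] \<phi>" "wf_fm [] \<psi>"
  shows "T (\<phi> \<^bold>\<longrightarrow> \<psi>) \<longleftrightarrow> (T \<phi> \<longrightarrow> T \<psi>)"
proof
  assume "T \<phi> \<longrightarrow> T \<psi>"
  then consider "T \<psi>" | "T (\<^bold>\<not> \<phi>)" using true_Neg assms by blast
  then show "T (\<phi> \<^bold>\<longrightarrow> \<psi>)"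
  proof cases
    case 1
    have "{\<psi>} \<^bold>\<turnstile> \<phi> \<^bold>\<longrightarrow> \<psi>" using assms by (intro ImpI Assm) simp_all
    then show ?thesis using 1 assms true_derivable1 by blast
  next
    case 2
    have "{\<phi>, \<^bold>\<not> \<phi>} \<^bold>\<turnstile> \<^bold>\<bottom>" by (rule ImpE[of _ \<phi>]; rule Assm) (use assms in simp_all)
    then have "{\<^bold>\<not> \<phi>} \<^bold>\<turnstile> \<phi> \<^bold>\<longrightarrow> \<psi>" using assms by (blast intro: ImpI explosion)
    then show ?thesis using 2 assms true_derivable1[of "\<^bold>\<not> \<phi>"] by simp
  qed
qed (use assms true_mp in blast)

lemma true_And:
  assumes "wf_fm [] \<phi>" "wf_fm [] \<psi>"
  shows "T (\<phi> \<^bold>\<and> \<psi>) \<longleftrightarrow> T \<phi> \<and> T \<psi>"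
proof
  assume c: "T (\<phi> \<^bold>\<and> \<psi>)"
  have "{\<phi> \<^bold>\<and> \<psi>} \<^bold>\<turnstile> \<phi> \<^bold>\<and> \<psi>" using assms by (intro Assm) simp_all
  then have "{\<phi> \<^bold>\<and> \<psi>} \<^bold>\<turnstile> \<phi>" "{\<phi> \<^bold>\<and> \<psi>} \<^bold>\<turnstile> \<psi>" by (rule AndE1, rule AndE2)
  then show "T \<phi> \<and> T \<psi>" using true_derivable1[OF c] assms by simp
next
  assume "T \<phi> \<and> T \<psi>"
  moreover have "{\<phi>, \<psi>} \<^bold>\<turnstile> \<phi> \<^bold>\<and> \<psi>" using assms by (intro AndI Assm) simp_all
  ultimately show "T (\<phi> \<^bold>\<and> \<psi>)" using assms true_derivable2 by blast
qed

lemma true_Or: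
  assumes "wf_fm [] \<phi>" "wf_fm [] \<psi>"
  shows "T (\<phi> \<^bold>\<or> \<psi>) \<longleftrightarrow> T \<phi> \<or> T \<psi>"
proof
  assume d: "T (\<phi> \<^bold>\<or> \<psi>)"
  show "T \<phi> \<or> T \<psi>"
  proof (rule ccontr)
    assume n: "\<not> (T \<phi> \<or> T \<psi>)"
    let ?H = "{\<phi> \<^bold>\<or> \<psi>, \<^bold>\<not> \<phi>, \<^bold>\<not> \<psi>}"
    have "?H \<^bold>\<turnstile> \<phi> \<^bold>\<or> \<psi>" using assms by (intro Assm) simp_all
    moreover have "insert \<phi> ?H \<^bold>\<turnstile> \<^bold>\<bottom>" by (rule ImpE[of _ \<phi>]; rule Assm) (use assms in simp_all)
    moreover have "insert \<psi> ?H \<^bold>\<turnstile> \<^bold>\<bottom>" by (rule ImpE[of _ \<psi>]; rule Assm) (use assms in simp_all)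
    ultimately have "?H \<^bold>\<turnstile> \<^bold>\<bottom>" by (rule OrE)
    moreover have "T (\<^bold>\<not> \<phi>)" "T (\<^bold>\<not> \<psi>)" using n assms true_Neg by blast+
    ultimately have "T \<^bold>\<bottom>" by (intro deductive[of ?H]) (use assms d in auto)
    then show False using consistent by blast
  qed
next
  assume "T \<phi> \<or> T \<psi>"
  moreover have "{\<phi>} \<^bold>\<turnstile> \<phi> \<^bold>\<or> \<psi>" using assms by (intro OrI1 Assm) simp_all
  moreover have "{\<psi>} \<^bold>\<turnstile> \<phi> \<^bold>\<or> \<psi>" using assms by (intro OrI2 Assm) simp_all
  ultimately show "T (\<phi> \<^bold>\<or> \<psi>)" using assms true_derivable1 by blast
qed

lemma true_Ex:
  assumes "wf_fm [\<sigma>] \<phi>"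
  shows "T (Ex \<sigma> \<phi>) \<longleftrightarrow> (\<exists>t. has_type [] t \<sigma> \<and> T (inst [t] \<phi>))"
proof
  assume "\<exists>t. has_type [] t \<sigma> \<and> T (inst [t] \<phi>)"
  then obtain t where t: "has_type [] t \<sigma>" "T (inst [t] \<phi>)" by blast
  have wf: "wf_fm [] (inst [t] \<phi>)" using assms t(1) by (rule wf_fm_inst1)
  then have "{inst [t] \<phi>} \<^bold>\<turnstile> Ex \<sigma> \<phi>" using assms t(1) Assm_insert by (blast intro: ExI)
  then show "T (Ex \<sigma> \<phi>)" using t(2) wf true_derivable1 by blast
qed (use assms witness in blast)

text \<open>If the universal formula is not in \<open>T\<close>, completeness puts its negation
  there, and the existential formula derived from it has a witness term, which is a
  counterexample.\<close>

lemma true_All: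
  assumes wf: "wf_fm [\<sigma>] \<phi>"
  shows "T (All \<sigma> \<phi>) \<longleftrightarrow> (\<forall>t. has_type [] t \<sigma> \<longrightarrow> T (inst [t] \<phi>))"
proof
  assume all: "T (All \<sigma> \<phi>)"
  have "{All \<sigma> \<phi>} \<^bold>\<turnstile> All \<sigma> \<phi>" using wf by (intro Assm) simp_all
  then show "\<forall>t. has_type [] t \<sigma> \<longrightarrow> T (inst [t] \<phi>)"
    using true_derivable1[OF all] wf AllE by auto
next
  assume inst: "\<forall>t. has_type [] t \<sigma> \<longrightarrow> T (inst [t] \<phi>)"
  show "T (All \<sigma> \<phi>)"
  proof (rule ccontr)
    assume "\<not> T (All \<sigma> \<phi>)"
    then have "T (\<^bold>\<not> All \<sigma> \<phi>)" using complete[of "All \<sigma> \<phi>"] wf by simp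
    then have "T (Ex \<sigma> (\<^bold>\<not> \<phi>))"
      using true_derivable1 not_All_derives_Ex_not[OF wf] wf by simp
    then obtain t where t: "has_type [] t \<sigma>" "T (inst [t] (\<^bold>\<not> \<phi>))"
      using true_Ex[of \<sigma> "\<^bold>\<not> \<phi>"] wf by auto
    then have "T (\<^bold>\<not> inst [t] \<phi>)" by (simp add: inst_def)
    then show False using inst t(1) true_Neg wf_fm_inst1[OF wf t(1)] by blast
  qed
qed

lemma true_AllD: "T (All \<sigma> \<phi>) \<Longrightarrow> wf_fm [\<sigma>] \<phi> \<Longrightarrow> has_type [] t \<sigma> \<Longrightarrow> T (inst [t] \<phi>)"
  using true_All by blast

text \<open>A closed term of type \<open>TNat\<close> need not equal a numeral in \<open>T\<close>,
  so induction on natural numbers outside \<open>T\<close> does not reach it. The induction axiom in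
  \<open>T\<close> does, at the price that the property must be given by a formula.\<close>

lemma true_nat_induct:
  assumes wf: "wf_fm [TNat] \<phi>" and base: "T (inst [zero] \<phi>)"
    and step: "\<And>n. has_type [] n TNat \<Longrightarrow> T (inst [n] \<phi>) \<Longrightarrow> T (inst [suc n] \<phi>)"
    and n: "has_type [] n TNat"
  shows "T (inst [n] \<phi>)"
proof -
  let ?\<psi> = "\<phi> \<^bold>\<longrightarrow> inst [suc (Bound 0)] \<phi>"
  have wf\<psi>: "wf_fm [TNat] ?\<psi>" using wf wf_fm_inst1[OF wf, of "[TNat]" "suc (Bound 0)"] by simp
  have "T (inst [k] ?\<psi>)" if k: "has_type [] k TNat" for k
  proof -
    have "inst [k] ?\<psi> = (inst [k] \<phi> \<^bold>\<longrightarrow> inst [suc k] \<phi>)"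
      using inst_inst_suc[OF wf, of k] by (simp add: inst_def)
    moreover have "wf_fm [] (inst [k] \<phi>)" "wf_fm [] (inst [suc k] \<phi>)"
      using wf k by (auto intro: wf_fm_inst1)
    ultimately show ?thesis using step[OF k] true_Imp by simp
  qed
  then have "T (All TNat ?\<psi>)" using true_All[OF wf\<psi>] by blast
  moreover have wf0: "wf_fm [] (inst [zero] \<phi>)" using wf by (rule wf_fm_inst1) simp
  ultimately have "T (inst [zero] \<phi> \<^bold>\<and> All TNat ?\<psi>)" using base true_And wf\<psi> by simp
  then have "T (All TNat \<phi>)"
    using true_mp[OF true_axiom[OF nat_induct[OF wf]]] wf wf\<psi> wf0 by simp
  then show ?thesis using true_All[OF wf] n by blast
qed

section \<open>Equality and sequence-building terms in a Henkin theory\<close>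

lemma true_refl: "has_type [] t \<sigma> \<Longrightarrow> T (t \<^bold>= t)"
  by (blast intro: true_axiom eq_refl)

lemma true_subst:
  assumes "T (t \<^bold>= s)" and t: "has_type [] t \<sigma>" and s: "has_type [] s \<sigma>"
    and wf: "wf_fm [\<sigma>] \<phi>" and "T (inst [t] \<phi>)"
  shows "T (inst [s] \<phi>)"
proof -
  have "T (t \<^bold>= s \<^bold>\<longrightarrow> inst [t] \<phi> \<^bold>\<longrightarrow> inst [s] \<phi>)" using t s wf by (intro true_axiom eq_subst)
  moreover have "wf_fm [] (t \<^bold>= s)" using t s by auto
  ultimately show ?thesis
    using assms true_Imp wf_fm_inst1[OF wf t] wf_fm_inst1[OF wf s] by simp
qed

lemma true_sym:
  assumes eq: "T (t \<^bold>= s)" and t: "has_type [] t \<sigma>" and s: "has_type [] s \<sigma>"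
  shows "T (s \<^bold>= t)"
  using true_subst[OF eq t s, of "Bound 0 \<^bold>= t"] true_refl[OF t] t
  by (simp add: inst_def closed_simps[OF t])

lemma true_trans:
  assumes rs: "T (r \<^bold>= s)" and st: "T (s \<^bold>= t)"
    and r: "has_type [] r \<sigma>" and s: "has_type [] s \<sigma>" and t: "has_type [] t \<sigma>"
  shows "T (r \<^bold>= t)"
  using true_subst[OF st s t, of "r \<^bold>= Bound 0"] rs by (simp add: inst_def closed_simps[OF r])

lemma true_App_cong:
  assumes fg: "T (f \<^bold>= g)" and ts: "T (t \<^bold>= s)"
    and f: "has_type [] f (\<sigma> \<^bold>\<Rightarrow> \<tau>)" and g: "has_type [] g (\<sigma> \<^bold>\<Rightarrow> \<tau>)"
    and t: "has_type [] t \<sigma>" and s: "has_type [] s \<sigma>"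
  shows "T (f \<cdot> t \<^bold>= g \<cdot> s)"
proof -
  note [simp] = closed_simps[OF f] closed_simps[OF g] closed_simps[OF t] closed_simps[OF s]
  have "T (f \<cdot> t \<^bold>= f \<cdot> t)" by (rule true_refl[of _ \<tau>]) simp
  then have "T (f \<cdot> t \<^bold>= g \<cdot> t)"
    using true_subst[OF fg f g, of "f \<cdot> t \<^bold>= Bound 0 \<cdot> t"] by (simp add: inst_def)
  then show ?thesis
    using true_subst[OF ts t s, of "f \<cdot> t \<^bold>= g \<cdot> Bound 0"] by (simp add: inst_def)
qed

text \<open>The term \<beta> is the sequence \<alpha> shifted by \<open>n\<close>, and the index
  \<open>j\<close> stands for \<open>n + k\<close>. The last property says that neighbours in
  \<beta> are neighbours in \<alpha>, which is the form needed to transfer descent.\<close>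

lemma tail_exists:
  assumes \<alpha>: "has_type [] \<alpha> (TNat \<^bold>\<Rightarrow> \<rho>)" and n: "has_type [] n TNat"
  obtains \<beta> where "has_type [] \<beta> (TNat \<^bold>\<Rightarrow> \<rho>)" and "T (\<beta> \<cdot> zero \<^bold>= \<alpha> \<cdot> n)"
    and "\<And>k. has_type [] k TNat \<Longrightarrow>
      \<exists>j. has_type [] j TNat \<and> T (\<beta> \<cdot> k \<^bold>= \<alpha> \<cdot> j) \<and> T (\<beta> \<cdot> suc k \<^bold>= \<alpha> \<cdot> suc j)"
proof -
  note [simp] = closed_simps[OF \<alpha>] closed_simps[OF n]
  \<comment> \<open>The recursion step ignores the counter and takes the successor of the previous
    value, so \<open>p\<close> maps \<open>k\<close> to \<open>n + k\<close>.\<close>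
  let ?K = "Con (CK (TNat \<^bold>\<Rightarrow> TNat) TNat) \<cdot> Con CSuc"
  define p where "p = Con (CRec TNat) \<cdot> n \<cdot> ?K"
  have p: "has_type [] p (TNat \<^bold>\<Rightarrow> TNat)" by (simp add: p_def)
  note [simp] = closed_simps[OF p]
  have p_zero: "T (p \<cdot> zero \<^bold>= n)"
    unfolding p_def by (intro true_axiom rec_zero) simp_all
  have p_suc: "T (p \<cdot> suc k \<^bold>= suc (p \<cdot> k))" if k: "has_type [] k TNat" for k
  proof -
    note [simp] = closed_simps[OF k]
    have "T (p \<cdot> suc k \<^bold>= ?K \<cdot> k \<cdot> (p \<cdot> k))"
      unfolding p_def by (intro true_axiom rec_suc) simp_all
    moreover have "T (?K \<cdot> k \<^bold>= Con CSuc)" by (intro true_axiom K_conv) simp_all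
    then have "T (?K \<cdot> k \<cdot> (p \<cdot> k) \<^bold>= suc (p \<cdot> k))"
      by (rule true_App_cong) (auto intro: true_refl)
    ultimately show ?thesis by (rule true_trans) auto
  qed
  \<comment> \<open>Without binders, the composition of \<alpha> with \<open>p\<close> is written by
    means of \<open>S\<close> and a constant function with value \<alpha>.\<close>
  let ?C = "Con (CK (TNat \<^bold>\<Rightarrow> \<rho>) TNat) \<cdot> \<alpha>"
  define \<beta> where "\<beta> = Con (CS TNat TNat \<rho>) \<cdot> ?C \<cdot> p"
  have \<beta>: "has_type [] \<beta> (TNat \<^bold>\<Rightarrow> \<rho>)" by (simp add: \<beta>_def)
  note [simp] = closed_simps[OF \<beta>]
  \<comment> \<open>This is used twice: with \<open>j\<close> the term \<open>p \<cdot> k\<close>,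
    and at \<open>suc k\<close> with \<open>j\<close> the term \<open>suc (p \<cdot> k)\<close>,
    which is justified by \<open>p_suc\<close>.\<close>
  have val: "T (\<beta> \<cdot> k \<^bold>= \<alpha> \<cdot> j)"
    if k: "has_type [] k TNat" and j: "has_type [] j TNat" and eq: "T (p \<cdot> k \<^bold>= j)" for k j
  proof -
    note [simp] = closed_simps[OF k] closed_simps[OF j]
    have "T (\<beta> \<cdot> k \<^bold>= ?C \<cdot> k \<cdot> (p \<cdot> k))"
      unfolding \<beta>_def by (intro true_axiom S_conv) simp_all
    moreover have "T (?C \<cdot> k \<^bold>= \<alpha>)" by (intro true_axiom K_conv) simp_all
    then have "T (?C \<cdot> k \<cdot> (p \<cdot> k) \<^bold>= \<alpha> \<cdot> j)" using eq by (rule true_App_cong) auto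
    ultimately show ?thesis by (rule true_trans) auto
  qed
  show thesis
  proof
    show "T (\<beta> \<cdot> zero \<^bold>= \<alpha> \<cdot> n)" by (rule val) (simp_all add: p_zero)
    fix k assume k: "has_type [] k TNat"
    note [simp] = closed_simps[OF k]
    have "T (p \<cdot> k \<^bold>= p \<cdot> k)" by (rule true_refl) simp
    then show "\<exists>j. has_type [] j TNat \<and> T (\<beta> \<cdot> k \<^bold>= \<alpha> \<cdot> j) \<and> T (\<beta> \<cdot> suc k \<^bold>= \<alpha> \<cdot> suc j)"
      by (intro exI[of _ "p \<cdot> k"] conjI val p_suc) simp_all
  qed (rule \<beta>)
qed

lemma cons_exists:
  assumes \<beta>: "has_type [] \<beta> (TNat \<^bold>\<Rightarrow> \<rho>)" and u: "has_type [] u \<rho>"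
  obtains \<gamma> where "has_type [] \<gamma> (TNat \<^bold>\<Rightarrow> \<rho>)" and "T (\<gamma> \<cdot> zero \<^bold>= u)"
    and "\<And>k. has_type [] k TNat \<Longrightarrow> T (\<gamma> \<cdot> suc k \<^bold>= \<beta> \<cdot> k)"
proof -
  note [simp] = closed_simps[OF \<beta>] closed_simps[OF u]
  \<comment> \<open>The recursion starts at \<open>u\<close>. Its step \<open>?f\<close> sends
    \<open>k\<close> and the previous value to \<open>\<beta> \<cdot> k\<close>: the combinator
    \<open>?K\<close> drops the previous value.\<close>
  let ?K = "Con (CK \<rho> \<rho>)"
  let ?C = "Con (CK (\<rho> \<^bold>\<Rightarrow> \<rho> \<^bold>\<Rightarrow> \<rho>) TNat) \<cdot> ?K"
  let ?f = "Con (CS TNat \<rho> (\<rho> \<^bold>\<Rightarrow> \<rho>)) \<cdot> ?C \<cdot> \<beta>"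
  define \<gamma> where "\<gamma> = Con (CRec \<rho>) \<cdot> u \<cdot> ?f"
  have \<gamma>: "has_type [] \<gamma> (TNat \<^bold>\<Rightarrow> \<rho>)" by (simp add: \<gamma>_def)
  note [simp] = closed_simps[OF \<gamma>]
  show thesis
  proof
    show "T (\<gamma> \<cdot> zero \<^bold>= u)" unfolding \<gamma>_def by (intro true_axiom rec_zero) simp_all
    fix k assume k: "has_type [] k TNat"
    note [simp] = closed_simps[OF k]
    have rec: "T (\<gamma> \<cdot> suc k \<^bold>= ?f \<cdot> k \<cdot> (\<gamma> \<cdot> k))"
      unfolding \<gamma>_def by (intro true_axiom rec_suc) simp_all
    have S: "T (?f \<cdot> k \<^bold>= ?C \<cdot> k \<cdot> (\<beta> \<cdot> k))" by (intro true_axiom S_conv) simp_all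
    have "T (?C \<cdot> k \<^bold>= ?K)" by (intro true_axiom K_conv) simp_all
    then have "T (?C \<cdot> k \<cdot> (\<beta> \<cdot> k) \<^bold>= ?K \<cdot> (\<beta> \<cdot> k))"
      by (rule true_App_cong) (auto intro: true_refl)
    with S have "T (?f \<cdot> k \<^bold>= ?K \<cdot> (\<beta> \<cdot> k))" by (rule true_trans) auto
    then have "T (?f \<cdot> k \<cdot> (\<gamma> \<cdot> k) \<^bold>= ?K \<cdot> (\<beta> \<cdot> k) \<cdot> (\<gamma> \<cdot> k))"
      by (rule true_App_cong) (auto intro: true_refl)
    moreover have "T (?K \<cdot> (\<beta> \<cdot> k) \<cdot> (\<gamma> \<cdot> k) \<^bold>= \<beta> \<cdot> k)"
      by (intro true_axiom K_conv) simp_all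
    ultimately have "T (?f \<cdot> k \<cdot> (\<gamma> \<cdot> k) \<^bold>= \<beta> \<cdot> k)" by (rule true_trans) auto
    with rec show "T (\<gamma> \<cdot> suc k \<^bold>= \<beta> \<cdot> k)" by (rule true_trans) auto
  qed (rule \<gamma>)
qed

end

section \<open>Well-foundedness in a Henkin theory\<close>

text \<open>A relation has only its two argument indices dangling, and \<open>subst\<close> leaves
  free parameters alone, so a substitution acts on the arguments only.\<close>

lemma subst_rel:
  "relation_on \<rho> R \<Longrightarrow> subst f (rel R x y) = rel R (subst_tm f x) (subst_tm f y)"
  unfolding relation_on_def rel_def by (subst subst_inst[of "[\<rho>, \<rho>]"]) simp_all

lemma wf_fm_rel:
  "relation_on \<rho> R \<Longrightarrow> has_type \<Delta> x \<rho> \<Longrightarrow> has_type \<Delta> y \<rho> \<Longrightarrow> wf_fm \<Delta> (rel R x y)"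
  unfolding relation_on_def rel_def inst_def by (erule wf_fm_subst) (auto simp: less_Suc_eq)

lemma subst_WF: "relation_on \<rho> R \<Longrightarrow> subst f (WF R \<alpha>) = WF R (subst_tm f \<alpha>)"
  by (simp add: WF_def subst_rel subst_tm_under_lift)

lemma wf_fm_WF: "relation_on \<rho> R \<Longrightarrow> has_type \<Delta> \<alpha> (TNat \<^bold>\<Rightarrow> \<rho>) \<Longrightarrow> wf_fm \<Delta> (WF R \<alpha>)"
  unfolding WF_def by (auto intro!: wf_fm_rel has_type_lift exI[of _ TNat])

lemma subst_eWF: "relation_on \<rho> R \<Longrightarrow> subst f (eWF \<rho> R x) = eWF \<rho> R (subst_tm f x)"
  by (simp add: eWF_def starts_def subst_WF subst_tm_under_lift)

lemma wf_fm_eWF: "relation_on \<rho> R \<Longrightarrow> has_type \<Delta> x \<rho> \<Longrightarrow> wf_fm \<Delta> (eWF \<rho> R x)"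
  unfolding eWF_def starts_def by (auto intro!: wf_fm_WF has_type_lift exI[of _ \<rho>])

lemma subst_accA:
  "relation_on \<rho> D \<Longrightarrow> relation_on \<rho> R \<Longrightarrow> subst f (accA \<rho> D R x) = accA \<rho> D R (subst_tm f x)"
  by (simp add: accA_def subst_rel subst_eWF subst_tm_under_lift)

lemma wf_fm_accA:
  "relation_on \<rho> D \<Longrightarrow> relation_on \<rho> R \<Longrightarrow> has_type \<Delta> x \<rho> \<Longrightarrow> wf_fm \<Delta> (accA \<rho> D R x)"
  unfolding accA_def by (auto intro!: wf_fm_rel wf_fm_eWF has_type_lift)

lemma wf_fm_eMIN:
  "relation_on \<rho> D \<Longrightarrow> relation_on \<rho> R \<Longrightarrow> has_type \<Delta> \<alpha> (TNat \<^bold>\<Rightarrow> \<rho>) \<Longrightarrow> wf_fm \<Delta> (eMIN \<rho> D R \<alpha>)"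
  unfolding eMIN_def by (auto intro!: wf_fm_rel wf_fm_eWF has_type_lift exI[of _ TNat])

lemma wf_fm_sTP:
  assumes "relation_on \<rho> D" "relation_on \<rho> R" "relation_on \<rho> R\<^sub>0"
  shows "wf_fm [] (sTP \<rho> D R R\<^sub>0)"
  unfolding sTP_def eWFA_def starts_def
  using assms by (auto intro!: wf_fm_rel[of \<rho>] wf_fm_eWF wf_fm_accA has_type_lift)

lemma wf_fm_eTP:
  assumes "relation_on \<rho> D" "relation_on \<rho> R"
  shows "wf_fm [] (eTP \<rho> D R)"
  unfolding eTP_def using assms by (auto intro!: wf_fm_eMIN wf_fm_WF wf_fm_eWF)

lemma wf_fm_decomposition:
  assumes "relation_on \<rho> D" "relation_on \<rho> R" "relation_on \<rho> R\<^sub>0"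
  shows "wf_fm [] (decomposition \<rho> D R R\<^sub>0)"
  unfolding decomposition_def releq_def using assms by (auto intro!: wf_fm_rel[of \<rho>])

lemma wf_fm_subrelation:
  assumes "relation_on \<rho> R" "relation_on \<rho> R\<^sub>0"
  shows "wf_fm [] (subrelation \<rho> R\<^sub>0 R)"
  unfolding subrelation_def using assms by (auto intro!: wf_fm_rel[of \<rho>])

section \<open>Truth conditions of the defined formulas over closed terms\<close>

locale henkin_relations = henkin_theory T for T +
  fixes \<rho> :: ty and D R R\<^sub>0 :: fm
  assumes D: "relation_on \<rho> D" and R: "relation_on \<rho> R" and R\<^sub>0: "relation_on \<rho> R\<^sub>0"
begin

lemmas wf_rels =
  wf_fm_rel[OF D] wf_fm_rel[OF R] wf_fm_rel[OF R\<^sub>0] wf_fm_WF[OF R] wf_fm_eWF[OF R]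
  wf_fm_accA[OF D R] wf_fm_eMIN[OF D R]

lemmas subst_rels =
  subst_rel[OF D] subst_rel[OF R] subst_rel[OF R\<^sub>0] subst_WF[OF R] subst_eWF[OF R]
  subst_accA[OF D R]

text \<open>Values of constructed sequences agree by equations in \<open>T\<close>, not as terms, so
  instances of a relation have to be transported by Leibniz's law, one argument at a time.\<close>

lemma true_rel_cong:
  assumes rel: "relation_on \<rho> S" and xx: "T (x \<^bold>= x')" and yy: "T (y \<^bold>= y')"
    and x: "has_type [] x \<rho>" and x': "has_type [] x' \<rho>"
    and y: "has_type [] y \<rho>" and y': "has_type [] y' \<rho>"
    and xy: "T (rel S x y)"
  shows "T (rel S x' y')"
proof -
  note [simp] = closed_simps[OF x] closed_simps[OF x'] closed_simps[OF y] closed_simps[OF y']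
  have "T (rel S x' y)"
    using true_subst[OF xx x x', of "rel S (Bound 0) y"] xy
    by (simp add: inst_def subst_rel[OF rel] wf_fm_rel[OF rel])
  then show ?thesis
    using true_subst[OF yy y y', of "rel S x' (Bound 0)"]
    by (simp add: inst_def subst_rel[OF rel] wf_fm_rel[OF rel])
qed

lemma true_WF:
  assumes \<alpha>: "has_type [] \<alpha> (TNat \<^bold>\<Rightarrow> \<rho>)"
  shows "T (WF R \<alpha>) \<longleftrightarrow> (\<exists>n. has_type [] n TNat \<and> \<not> T (rel R (\<alpha> \<cdot> n) (\<alpha> \<cdot> suc n)))"
proof -
  note [simp] = closed_simps[OF \<alpha>]
  have "T (inst [n] (\<^bold>\<not> rel R (lift \<alpha> \<cdot> Bound 0) (lift \<alpha> \<cdot> suc (Bound 0)))) \<longleftrightarrow>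
      \<not> T (rel R (\<alpha> \<cdot> n) (\<alpha> \<cdot> suc n))" if "has_type [] n TNat" for n
    using that by (simp add: inst_def subst_rels true_Neg wf_rels)
  then show ?thesis unfolding WF_def by (subst true_Ex) (auto simp: wf_rels)
qed

lemma true_eWF:
  assumes x: "has_type [] x \<rho>"
  shows "T (eWF \<rho> R x) \<longleftrightarrow>
    (\<forall>\<alpha>. has_type [] \<alpha> (TNat \<^bold>\<Rightarrow> \<rho>) \<longrightarrow> T (\<alpha> \<cdot> zero \<^bold>= x) \<longrightarrow> T (WF R \<alpha>))"
proof -
  note [simp] = closed_simps[OF x]
  have "T (inst [\<alpha>] (starts (lift x) (Bound 0) \<^bold>\<longrightarrow> WF R (Bound 0))) \<longleftrightarrow>
      (T (\<alpha> \<cdot> zero \<^bold>= x) \<longrightarrow> T (WF R \<alpha>))" if "has_type [] \<alpha> (TNat \<^bold>\<Rightarrow> \<rho>)" for \<alpha>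
    using closed_simps[OF that] by (simp add: inst_def starts_def subst_rels true_Imp wf_rels)
  then show ?thesis unfolding eWF_def by (subst true_All) (auto simp: wf_rels starts_def)
qed

lemma true_accA:
  assumes x: "has_type [] x \<rho>"
  shows "T (accA \<rho> D R x) \<longleftrightarrow>
    (\<forall>y. has_type [] y \<rho> \<longrightarrow> T (rel D x y) \<longrightarrow> T (eWF \<rho> R y))"
proof -
  note [simp] = closed_simps[OF x]
  have "T (inst [y] (rel D (lift x) (Bound 0) \<^bold>\<longrightarrow> eWF \<rho> R (Bound 0))) \<longleftrightarrow>
      (T (rel D x y) \<longrightarrow> T (eWF \<rho> R y))" if "has_type [] y \<rho>" for y
    using closed_simps[OF that] by (simp add: inst_def subst_rels true_Imp wf_rels)
  then show ?thesis unfolding accA_def by (subst true_All) (auto simp: wf_rels)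
qed

lemma true_eMIN:
  assumes \<alpha>: "has_type [] \<alpha> (TNat \<^bold>\<Rightarrow> \<rho>)"
  shows "T (eMIN \<rho> D R \<alpha>) \<longleftrightarrow>
    (\<forall>y. has_type [] y \<rho> \<longrightarrow> T (rel D (\<alpha> \<cdot> zero) y) \<longrightarrow> T (eWF \<rho> R y)) \<and>
    (\<forall>n y. has_type [] n TNat \<longrightarrow> has_type [] y \<rho> \<longrightarrow> T (rel R (\<alpha> \<cdot> n) y) \<longrightarrow>
      T (rel D (\<alpha> \<cdot> suc n) y) \<longrightarrow> T (eWF \<rho> R y))"
proof -
  note [simp] = closed_simps[OF \<alpha>] inst_def subst_rels true_And true_Imp wf_rels
  let ?\<phi> = "rel D (\<alpha> \<cdot> zero) (Bound 0) \<^bold>\<longrightarrow> eWF \<rho> R (Bound 0)"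
  let ?\<psi> = "\<lambda>n. rel R (\<alpha> \<cdot> n) (Bound 0) \<^bold>\<and> rel D (\<alpha> \<cdot> suc n) (Bound 0) \<^bold>\<longrightarrow> eWF \<rho> R (Bound 0)"
  have "T (inst [y] ?\<phi>) \<longleftrightarrow> (T (rel D (\<alpha> \<cdot> zero) y) \<longrightarrow> T (eWF \<rho> R y))"
    if "has_type [] y \<rho>" for y
    using closed_simps[OF that] by simp
  then have "T (All \<rho> ?\<phi>) \<longleftrightarrow>
      (\<forall>y. has_type [] y \<rho> \<longrightarrow> T (rel D (\<alpha> \<cdot> zero) y) \<longrightarrow> T (eWF \<rho> R y))"
    by (subst true_All) auto
  moreover have "T (All \<rho> (?\<psi> n)) \<longleftrightarrow> (\<forall>y. has_type [] y \<rho> \<longrightarrow> T (rel R (\<alpha> \<cdot> n) y) \<longrightarrow>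
      T (rel D (\<alpha> \<cdot> suc n) y) \<longrightarrow> T (eWF \<rho> R y))" if n: "has_type [] n TNat" for n
  proof -
    have "T (inst [y] (?\<psi> n)) \<longleftrightarrow>
        (T (rel R (\<alpha> \<cdot> n) y) \<longrightarrow> T (rel D (\<alpha> \<cdot> suc n) y) \<longrightarrow> T (eWF \<rho> R y))"
      if "has_type [] y \<rho>" for y
      using closed_simps[OF that] closed_simps[OF n] by auto
    then show ?thesis using closed_simps[OF n] by (subst true_All) auto
  qed
  \<comment> \<open>Under the inner quantifier the outer variable is \<open>Bound 1\<close>, which
    is where \<open>n\<close> arrives.\<close>
  moreover have "inst [n] (All \<rho> (?\<psi> (Bound 1))) = All \<rho> (?\<psi> n)" if "has_type [] n TNat" for n
    using closed_simps[OF that] by simp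
  moreover have "T (All TNat (All \<rho> (?\<psi> (Bound 1)))) \<longleftrightarrow>
      (\<forall>n. has_type [] n TNat \<longrightarrow> T (inst [n] (All \<rho> (?\<psi> (Bound 1)))))"
    by (rule true_All) auto
  ultimately show ?thesis unfolding eMIN_def by (subst true_And) (auto simp del: inst_def)
qed

lemma true_eTP:
  "T (eTP \<rho> D R) \<longleftrightarrow>
    ((\<forall>\<alpha>. has_type [] \<alpha> (TNat \<^bold>\<Rightarrow> \<rho>) \<longrightarrow> T (eMIN \<rho> D R \<alpha>) \<longrightarrow> T (WF R \<alpha>)) \<longrightarrow>
     (\<forall>x. has_type [] x \<rho> \<longrightarrow> T (eWF \<rho> R x)))"
proof -
  let ?\<phi> = "eMIN \<rho> D R (Bound 0) \<^bold>\<longrightarrow> WF R (Bound 0)"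
  have "T (inst [\<alpha>] ?\<phi>) \<longleftrightarrow> (T (eMIN \<rho> D R \<alpha>) \<longrightarrow> T (WF R \<alpha>))"
    if \<alpha>: "has_type [] \<alpha> (TNat \<^bold>\<Rightarrow> \<rho>)" for \<alpha>
  proof -
    have "inst [\<alpha>] ?\<phi> = (eMIN \<rho> D R \<alpha> \<^bold>\<longrightarrow> WF R \<alpha>)"
      using closed_simps[OF \<alpha>] by (simp add: inst_def eMIN_def subst_rels subst_tm_under_lift)
    then show ?thesis using \<alpha> true_Imp by (simp add: wf_rels)
  qed
  moreover have "inst [x] (eWF \<rho> R (Bound 0)) = eWF \<rho> R x" for x
    by (simp add: inst_def subst_rels)
  ultimately show ?thesis unfolding eTP_def
    by (subst true_Imp) (auto simp: wf_rels true_All)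
qed

text \<open>The starting point disappears: each sequence \<alpha> starts at the closed term
  \<open>\<alpha> \<cdot> zero\<close>, so quantifying over all \<open>x\<close> and all sequences
  from \<open>x\<close> amounts to quantifying over all sequences.\<close>

lemma true_sTP:
  "T (sTP \<rho> D R R\<^sub>0) \<longleftrightarrow>
    ((\<forall>\<alpha>. has_type [] \<alpha> (TNat \<^bold>\<Rightarrow> \<rho>) \<longrightarrow>
        (\<forall>n. has_type [] n TNat \<longrightarrow> T (accA \<rho> D R (\<alpha> \<cdot> n))) \<longrightarrow>
        (\<exists>n. has_type [] n TNat \<and> \<not> T (rel R\<^sub>0 (\<alpha> \<cdot> n) (\<alpha> \<cdot> suc n)))) \<longrightarrow>
     (\<forall>x. has_type [] x \<rho> \<longrightarrow> T (eWF \<rho> R x)))"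
proof -
  let ?A = "\<lambda>\<alpha>. All TNat (accA \<rho> D R (\<alpha> \<cdot> Bound 0))"
  let ?E = "\<lambda>\<alpha>. Ex TNat (\<^bold>\<not> rel R\<^sub>0 (\<alpha> \<cdot> Bound 0) (\<alpha> \<cdot> suc (Bound 0)))"
  let ?P = "\<lambda>\<alpha>. (\<forall>n. has_type [] n TNat \<longrightarrow> T (accA \<rho> D R (\<alpha> \<cdot> n))) \<longrightarrow>
    (\<exists>n. has_type [] n TNat \<and> \<not> T (rel R\<^sub>0 (\<alpha> \<cdot> n) (\<alpha> \<cdot> suc n)))"
  have wf: "wf_fm [] (eWFA \<rho> D R R\<^sub>0 x)" if "has_type [] x \<rho>" for x
    using has_type_lift[OF that] by (auto simp: eWFA_def starts_def intro!: wf_rels)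
  have body: "T (?A \<alpha> \<^bold>\<and> starts x \<alpha> \<^bold>\<longrightarrow> ?E \<alpha>) \<longleftrightarrow> (T (\<alpha> \<cdot> zero \<^bold>= x) \<longrightarrow> ?P \<alpha>)"
    if \<alpha>: "has_type [] \<alpha> (TNat \<^bold>\<Rightarrow> \<rho>)" and x: "has_type [] x \<rho>" for \<alpha> x
  proof -
    note [simp] = closed_simps[OF \<alpha>] closed_simps[OF x] wf_rels
    have "T (?A \<alpha>) \<longleftrightarrow> (\<forall>n. has_type [] n TNat \<longrightarrow> T (accA \<rho> D R (\<alpha> \<cdot> n)))"
      by (subst true_All) (auto simp: inst_def subst_rels)
    moreover have "T (inst [n] (\<^bold>\<not> rel R\<^sub>0 (\<alpha> \<cdot> Bound 0) (\<alpha> \<cdot> suc (Bound 0)))) \<longleftrightarrow>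
        \<not> T (rel R\<^sub>0 (\<alpha> \<cdot> n) (\<alpha> \<cdot> suc n))" if "has_type [] n TNat" for n
      using that by (simp add: inst_def subst_rels true_Neg)
    then have "T (?E \<alpha>) \<longleftrightarrow>
        (\<exists>n. has_type [] n TNat \<and> \<not> T (rel R\<^sub>0 (\<alpha> \<cdot> n) (\<alpha> \<cdot> suc n)))"
      by (subst true_Ex) auto
    ultimately show ?thesis by (auto simp: true_Imp true_And starts_def)
  qed
  have eWFA: "T (eWFA \<rho> D R R\<^sub>0 x) \<longleftrightarrow>
      (\<forall>\<alpha>. has_type [] \<alpha> (TNat \<^bold>\<Rightarrow> \<rho>) \<longrightarrow> T (\<alpha> \<cdot> zero \<^bold>= x) \<longrightarrow> ?P \<alpha>)" if x: "has_type [] x \<rho>" for x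
  proof -
    note [simp] = closed_simps[OF x]
    let ?\<phi> = "All TNat (accA \<rho> D R (Bound 1 \<cdot> Bound 0)) \<^bold>\<and> starts x (Bound 0)
      \<^bold>\<longrightarrow> Ex TNat (\<^bold>\<not> rel R\<^sub>0 (Bound 1 \<cdot> Bound 0) (Bound 1 \<cdot> suc (Bound 0)))"
    have "inst [\<alpha>] ?\<phi> = (?A \<alpha> \<^bold>\<and> starts x \<alpha> \<^bold>\<longrightarrow> ?E \<alpha>)" if "has_type [] \<alpha> (TNat \<^bold>\<Rightarrow> \<rho>)" for \<alpha>
      using closed_simps[OF that] by (simp add: inst_def subst_rels starts_def)
    then have "T (inst [\<alpha>] ?\<phi>) \<longleftrightarrow> (T (\<alpha> \<cdot> zero \<^bold>= x) \<longrightarrow> ?P \<alpha>)"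
      if "has_type [] \<alpha> (TNat \<^bold>\<Rightarrow> \<rho>)" for \<alpha>
      using body[OF that x] that by simp
    moreover have "wf_fm [TNat \<^bold>\<Rightarrow> \<rho>] ?\<phi>" using wf[OF x] by (simp add: eWFA_def)
    ultimately show ?thesis by (simp add: eWFA_def true_All)
  qed
  have "inst [x] (eWFA \<rho> D R R\<^sub>0 (Bound 0)) = eWFA \<rho> D R R\<^sub>0 x" if "has_type [] x \<rho>" for x
    using closed_simps[OF that] by (simp add: inst_def eWFA_def starts_def subst_rels)
  moreover have "inst [x] (eWF \<rho> R (Bound 0)) = eWF \<rho> R x" for x
    by (simp add: inst_def subst_rels)
  moreover have "wf_fm [\<rho>] (eWFA \<rho> D R R\<^sub>0 (Bound 0))"
    by (auto simp: eWFA_def starts_def intro!: wf_rels)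
  ultimately have "T (sTP \<rho> D R R\<^sub>0) \<longleftrightarrow>
      ((\<forall>x. has_type [] x \<rho> \<longrightarrow> T (eWFA \<rho> D R R\<^sub>0 x)) \<longrightarrow>
       (\<forall>x. has_type [] x \<rho> \<longrightarrow> T (eWF \<rho> R x)))"
    unfolding sTP_def by (subst true_Imp) (auto simp: wf_rels true_All)
  moreover have "(\<forall>x. has_type [] x \<rho> \<longrightarrow> T (eWFA \<rho> D R R\<^sub>0 x)) \<longleftrightarrow>
      (\<forall>\<alpha>. has_type [] \<alpha> (TNat \<^bold>\<Rightarrow> \<rho>) \<longrightarrow> ?P \<alpha>)"
  proof -
    have "has_type [] (\<alpha> \<cdot> zero) \<rho> \<and> T (\<alpha> \<cdot> zero \<^bold>= \<alpha> \<cdot> zero)"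
      if "has_type [] \<alpha> (TNat \<^bold>\<Rightarrow> \<rho>)" for \<alpha>
      using closed_simps[OF that] by (auto intro: true_refl[of _ \<rho>])
    then show ?thesis using eWFA by blast
  qed
  ultimately show ?thesis by simp
qed

lemma decomposition_cases:
  assumes dec: "T (decomposition \<rho> D R R\<^sub>0)" and x: "has_type [] x \<rho>" and y: "has_type [] y \<rho>"
    and xy: "T (rel R x y)"
  obtains u where "has_type [] u \<rho>" "T (rel D x u)" "T (rel R u y) \<or> T (u \<^bold>= y)"
    | "T (rel R\<^sub>0 x y)"
proof -
  \<comment> \<open>\<open>numeral_2_eq_2\<close> puts the index of \<open>Bound 2\<close> into
    successor form, on which \<open>under\<close> computes.\<close>
  note [simp] = closed_simps[OF x] closed_simps[OF y] inst_def subst_rels wf_rels releq_def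
    numeral_2_eq_2
  \<comment> \<open>The quantifiers are removed one by one: \<open>?\<phi>\<close> is the original
    matrix, \<open>?\<psi>\<close> the matrix after inserting \<open>x\<close>, and
    \<open>?\<chi>\<close> the body of the existential formula after inserting \<open>y\<close> as
    well.\<close>
  let ?\<phi> = "rel R (Bound 1) (Bound 0) \<^bold>\<longrightarrow>
    Ex \<rho> (rel D (Bound 2) (Bound 0) \<^bold>\<and> releq R (Bound 0) (Bound 1)) \<^bold>\<or> rel R\<^sub>0 (Bound 1) (Bound 0)"
  let ?\<psi> = "rel R x (Bound 0) \<^bold>\<longrightarrow>
    Ex \<rho> (rel D x (Bound 0) \<^bold>\<and> releq R (Bound 0) (Bound 1)) \<^bold>\<or> rel R\<^sub>0 x (Bound 0)"
  let ?\<chi> = "rel D x (Bound 0) \<^bold>\<and> releq R (Bound 0) y"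
  have "T (All \<rho> (All \<rho> ?\<phi>))"
    using dec wf_fm_decomposition[OF D R R\<^sub>0] true_And unfolding decomposition_def by simp
  then have "T (inst [x] (All \<rho> ?\<phi>))" by (rule true_AllD) auto
  then have "T (All \<rho> ?\<psi>)" by simp
  then have "T (inst [y] ?\<psi>)" by (rule true_AllD) auto
  then have "T (rel R x y \<^bold>\<longrightarrow> Ex \<rho> ?\<chi> \<^bold>\<or> rel R\<^sub>0 x y)" by simp
  then have "T (Ex \<rho> ?\<chi>) \<or> T (rel R\<^sub>0 x y)" using xy by (simp add: true_Imp true_Or)
  moreover have "\<exists>u. has_type [] u \<rho> \<and> T (rel D x u) \<and> (T (rel R u y) \<or> T (u \<^bold>= y))"
    if "T (Ex \<rho> ?\<chi>)"
  proof -
    obtain u where u: "has_type [] u \<rho>" and "T (inst [u] ?\<chi>)"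
      using \<open>T (Ex \<rho> ?\<chi>)\<close> by (subst (asm) true_Ex) auto
    then have "T (rel D x u \<^bold>\<and> (rel R u y \<^bold>\<or> u \<^bold>= y))" by simp
    then show ?thesis using u by (auto simp: true_And true_Or)
  qed
  ultimately show thesis using that by blast
qed

lemma decomposition_below:
  assumes dec: "T (decomposition \<rho> D R R\<^sub>0)"
    and x: "has_type [] x \<rho>" and y: "has_type [] y \<rho>" and u: "has_type [] u \<rho>"
    and xy: "T (rel R\<^sub>0 x y)" and yu: "T (rel D y u)"
  shows "T (rel R x u)"
proof -
  note [simp] = closed_simps[OF x] closed_simps[OF y] closed_simps[OF u]
    inst_def subst_rels wf_rels numeral_2_eq_2
  let ?\<phi> = "rel R\<^sub>0 (Bound 1) (Bound 0) \<^bold>\<longrightarrow>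
    All \<rho> (rel D (Bound 1) (Bound 0) \<^bold>\<longrightarrow> rel R (Bound 2) (Bound 0))"
  let ?\<psi> = "rel R\<^sub>0 x (Bound 0) \<^bold>\<longrightarrow>
    All \<rho> (rel D (Bound 1) (Bound 0) \<^bold>\<longrightarrow> rel R x (Bound 0))"
  let ?\<chi> = "rel D y (Bound 0) \<^bold>\<longrightarrow> rel R x (Bound 0)"
  have "T (All \<rho> (All \<rho> ?\<phi>))"
    using dec wf_fm_decomposition[OF D R R\<^sub>0] true_And unfolding decomposition_def by simp
  then have "T (inst [x] (All \<rho> ?\<phi>))" by (rule true_AllD) auto
  then have "T (All \<rho> ?\<psi>)" by simp
  then have "T (inst [y] ?\<psi>)" by (rule true_AllD) auto
  then have "T (rel R\<^sub>0 x y \<^bold>\<longrightarrow> All \<rho> ?\<chi>)" by simp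
  then have "T (All \<rho> ?\<chi>)" using xy by (simp add: true_Imp)
  then have "T (inst [u] ?\<chi>)" by (rule true_AllD) auto
  then show ?thesis using yu by (simp add: true_Imp)
qed

lemma subrelationD:
  assumes sub: "T (subrelation \<rho> R\<^sub>0 R)" and x: "has_type [] x \<rho>" and y: "has_type [] y \<rho>"
    and xy: "T (rel R\<^sub>0 x y)"
  shows "T (rel R x y)"
proof -
  note [simp] = closed_simps[OF x] closed_simps[OF y] inst_def subst_rels wf_rels
  let ?\<phi> = "rel R\<^sub>0 (Bound 1) (Bound 0) \<^bold>\<longrightarrow> rel R (Bound 1) (Bound 0)"
  let ?\<psi> = "rel R\<^sub>0 x (Bound 0) \<^bold>\<longrightarrow> rel R x (Bound 0)"
  have "T (All \<rho> (All \<rho> ?\<phi>))" using sub unfolding subrelation_def .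
  then have "T (inst [x] (All \<rho> ?\<phi>))" by (rule true_AllD) auto
  then have "T (All \<rho> ?\<psi>)" by simp
  then have "T (inst [y] ?\<psi>)" by (rule true_AllD) auto
  then show ?thesis using xy by (simp add: true_Imp)
qed

section \<open>Descending sequences\<close>

text \<open>\<open>eWF\<close> only speaks about sequences whose value at \<open>zero\<close> is the
  given element, so the tail of \<alpha> from \<open>n\<close> on serves as the descending
  sequence.\<close>

lemma not_eWF_of_descending:
  assumes \<alpha>: "has_type [] \<alpha> (TNat \<^bold>\<Rightarrow> \<rho>)" and n: "has_type [] n TNat"
    and desc: "\<And>k. has_type [] k TNat \<Longrightarrow> T (rel R (\<alpha> \<cdot> k) (\<alpha> \<cdot> suc k))"
  shows "\<not> T (eWF \<rho> R (\<alpha> \<cdot> n))"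
proof
  assume eWF: "T (eWF \<rho> R (\<alpha> \<cdot> n))"
  obtain \<beta> where \<beta>: "has_type [] \<beta> (TNat \<^bold>\<Rightarrow> \<rho>)" and start: "T (\<beta> \<cdot> zero \<^bold>= \<alpha> \<cdot> n)"
    and val: "\<And>k. has_type [] k TNat \<Longrightarrow>
      \<exists>j. has_type [] j TNat \<and> T (\<beta> \<cdot> k \<^bold>= \<alpha> \<cdot> j) \<and> T (\<beta> \<cdot> suc k \<^bold>= \<alpha> \<cdot> suc j)"
    using tail_exists[OF \<alpha> n] by blast
  note [simp] = closed_simps[OF \<alpha>] closed_simps[OF \<beta>] closed_simps[OF n]
  have "T (WF R \<beta>)" using eWF \<beta> start true_eWF[of "\<alpha> \<cdot> n"] by simp
  then obtain k where k: "has_type [] k TNat" and "\<not> T (rel R (\<beta> \<cdot> k) (\<beta> \<cdot> suc k))"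
    using true_WF[OF \<beta>] by blast
  moreover obtain j where j: "has_type [] j TNat"
    and "T (\<beta> \<cdot> k \<^bold>= \<alpha> \<cdot> j)" "T (\<beta> \<cdot> suc k \<^bold>= \<alpha> \<cdot> suc j)" using val[OF k] by blast
  then have "T (\<alpha> \<cdot> j \<^bold>= \<beta> \<cdot> k)" "T (\<alpha> \<cdot> suc j \<^bold>= \<beta> \<cdot> suc k)"
    using j k by (auto intro: true_sym[of _ _ \<rho>])
  then have "T (rel R (\<beta> \<cdot> k) (\<beta> \<cdot> suc k))"
    by (rule true_rel_cong[OF R]) (use desc j k in auto)
  ultimately show False by blast
qed

lemma eWF_cong:
  assumes x: "has_type [] x \<rho>" and y: "has_type [] y \<rho>"
    and eWF: "T (eWF \<rho> R x)" and eq: "T (x \<^bold>= y)"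
  shows "T (eWF \<rho> R y)"
  using true_subst[OF eq x y, of "eWF \<rho> R (Bound 0)"] eWF
  by (simp add: inst_def subst_rels wf_rels)

text \<open>A descending sequence from \<open>v\<close> becomes a descending sequence from
  \<open>u\<close> when \<open>u\<close> is put in front.\<close>

lemma eWF_successor:
  assumes u: "has_type [] u \<rho>" and v: "has_type [] v \<rho>"
    and eWF: "T (eWF \<rho> R u)" and uv: "T (rel R u v)"
  shows "T (eWF \<rho> R v)"
proof -
  have "T (WF R \<beta>)" if \<beta>: "has_type [] \<beta> (TNat \<^bold>\<Rightarrow> \<rho>)" and start: "T (\<beta> \<cdot> zero \<^bold>= v)" for \<beta>
  proof (rule ccontr)
    assume "\<not> T (WF R \<beta>)"
    then have desc: "T (rel R (\<beta> \<cdot> k) (\<beta> \<cdot> suc k))" if "has_type [] k TNat" for k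
      using true_WF[OF \<beta>] that by blast
    obtain \<gamma> where \<gamma>: "has_type [] \<gamma> (TNat \<^bold>\<Rightarrow> \<rho>)" and \<gamma>_zero: "T (\<gamma> \<cdot> zero \<^bold>= u)"
      and \<gamma>_suc: "\<And>k. has_type [] k TNat \<Longrightarrow> T (\<gamma> \<cdot> suc k \<^bold>= \<beta> \<cdot> k)"
      using cons_exists[OF \<beta> u] by blast
    note [simp] = closed_simps[OF \<beta>] closed_simps[OF \<gamma>] closed_simps[OF u] closed_simps[OF v]
    have suc_\<gamma>: "T (\<beta> \<cdot> k \<^bold>= \<gamma> \<cdot> suc k)" if "has_type [] k TNat" for k
      using \<gamma>_suc[OF that] by (rule true_sym[of _ _ \<rho>]) (use that in simp_all)
    let ?\<phi> = "rel R (\<gamma> \<cdot> Bound 0) (\<gamma> \<cdot> suc (Bound 0))"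
    have inst: "inst [k] ?\<phi> = rel R (\<gamma> \<cdot> k) (\<gamma> \<cdot> suc k)" for k
      by (simp add: inst_def subst_rels)
    have "T (inst [k] ?\<phi>)" if k: "has_type [] k TNat" for k
    \<comment> \<open>The split into \<open>zero\<close> and successors goes through the induction
      axiom, because \<open>k\<close> is an arbitrary closed term. At \<open>zero\<close> the claim
      is the given relation between \<open>u\<close> and \<open>v\<close>; at a successor it is the
      descent of \<beta> one place earlier.\<close>
    proof (rule true_nat_induct[OF _ _ _ k])
      show "wf_fm [TNat] ?\<phi>" by (simp add: wf_rels)
      have "T (u \<^bold>= \<gamma> \<cdot> zero)" using \<gamma>_zero by (rule true_sym[of _ _ \<rho>]) simp_all
      moreover have "T (v \<^bold>= \<beta> \<cdot> zero)" using start by (rule true_sym[of _ _ \<rho>]) simp_all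
      then have "T (v \<^bold>= \<gamma> \<cdot> suc zero)"
        by (rule true_trans[where s = "\<beta> \<cdot> zero"]) (simp_all add: suc_\<gamma>)
      ultimately show "T (inst [zero] ?\<phi>)"
        unfolding inst by (rule true_rel_cong[OF R]) (simp_all add: uv)
      fix n assume n: "has_type [] n TNat"
      show "T (inst [suc n] ?\<phi>)" unfolding inst
        by (rule true_rel_cong[OF R, where x = "\<beta> \<cdot> n" and y = "\<beta> \<cdot> suc n"])
          (simp_all add: suc_\<gamma> desc n)
    qed
    then have "\<not> T (WF R \<gamma>)" using true_WF[OF \<gamma>] inst by simp
    then show False using eWF \<gamma> \<gamma>_zero true_eWF[OF u] by blast
  qed
  then show ?thesis using true_eWF[OF v] by blast
qed

section \<open>The two implications between the termination principles\<close>

lemma sTP_if_eTP: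
  assumes dec: "T (decomposition \<rho> D R R\<^sub>0)" and eTP: "T (eTP \<rho> D R)"
  shows "T (sTP \<rho> D R R\<^sub>0)"
  unfolding true_sTP
proof
  assume eWFA: "\<forall>\<alpha>. has_type [] \<alpha> (TNat \<^bold>\<Rightarrow> \<rho>) \<longrightarrow>
    (\<forall>n. has_type [] n TNat \<longrightarrow> T (accA \<rho> D R (\<alpha> \<cdot> n))) \<longrightarrow>
    (\<exists>n. has_type [] n TNat \<and> \<not> T (rel R\<^sub>0 (\<alpha> \<cdot> n) (\<alpha> \<cdot> suc n)))"
  have "T (WF R \<alpha>)" if \<alpha>: "has_type [] \<alpha> (TNat \<^bold>\<Rightarrow> \<rho>)" and min: "T (eMIN \<rho> D R \<alpha>)" for \<alpha>
  proof (rule ccontr)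
    assume "\<not> T (WF R \<alpha>)"
    then have desc: "T (rel R (\<alpha> \<cdot> k) (\<alpha> \<cdot> suc k))" if "has_type [] k TNat" for k
      using true_WF[OF \<alpha>] that by blast
    note [simp] = closed_simps[OF \<alpha>]
    have step: "T (rel R\<^sub>0 (\<alpha> \<cdot> n) (\<alpha> \<cdot> suc n))"
      if n: "has_type [] n TNat" and acc: "T (accA \<rho> D R (\<alpha> \<cdot> n))" for n
    proof -
      have types: "has_type [] (\<alpha> \<cdot> n) \<rho>" "has_type [] (\<alpha> \<cdot> suc n) \<rho>" using n by simp_all
      show ?thesis
      proof (rule decomposition_cases[OF dec types desc[OF n]])
        \<comment> \<open>This alternative is impossible: \<open>u\<close> is well-founded by
          \<open>acc\<close>, hence so is the next value of \<alpha>, which contradicts the descent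
          of \<alpha>. The other alternative is the claim itself.\<close>
        fix u assume u: "has_type [] u \<rho>" and "T (rel D (\<alpha> \<cdot> n) u)"
          and above: "T (rel R u (\<alpha> \<cdot> suc n)) \<or> T (u \<^bold>= \<alpha> \<cdot> suc n)"
        then have "T (eWF \<rho> R u)" using acc true_accA[OF types(1)] by blast
        then have "T (eWF \<rho> R (\<alpha> \<cdot> suc n))"
          using above eWF_successor[OF u types(2)] eWF_cong[OF u types(2)] by blast
        moreover have "\<not> T (eWF \<rho> R (\<alpha> \<cdot> suc n))"
          by (rule not_eWF_of_descending[OF \<alpha> _ desc]) (use n in simp_all)
        ultimately show ?thesis by blast
      qed
    qed
    have acc: "T (accA \<rho> D R (\<alpha> \<cdot> n))" if n: "has_type [] n TNat" for n
    proof -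
      have inst: "inst [k] (accA \<rho> D R (\<alpha> \<cdot> Bound 0)) = accA \<rho> D R (\<alpha> \<cdot> k)" for k
        by (simp add: inst_def subst_rels)
      have "T (inst [n] (accA \<rho> D R (\<alpha> \<cdot> Bound 0)))"
      proof (rule true_nat_induct[OF _ _ _ n])
        show "wf_fm [TNat] (accA \<rho> D R (\<alpha> \<cdot> Bound 0))" by (simp add: wf_rels)
        \<comment> \<open>At index zero minimality has no predecessor condition, so its first
          conjunct is the claim.\<close>
        show "T (inst [zero] (accA \<rho> D R (\<alpha> \<cdot> Bound 0)))"
          unfolding inst using min true_eMIN[OF \<alpha>] true_accA[of "\<alpha> \<cdot> zero"] by simp
      next
        fix k assume k: "has_type [] k TNat" and "T (inst [k] (accA \<rho> D R (\<alpha> \<cdot> Bound 0)))"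
        then have R\<^sub>0_step: "T (rel R\<^sub>0 (\<alpha> \<cdot> k) (\<alpha> \<cdot> suc k))" using step inst by simp
        have types: "has_type [] (\<alpha> \<cdot> k) \<rho>" "has_type [] (\<alpha> \<cdot> suc k) \<rho>" using k by simp_all
        \<comment> \<open>Minimality at the successor index also asks that
          \<open>\<alpha> \<cdot> k\<close> be related to \<open>y\<close> by \<open>R\<close>. The
          second clause of the decomposition supplies this from
          \<open>R\<^sub>0_step\<close>.\<close>
        have "T (eWF \<rho> R y)" if y: "has_type [] y \<rho>" and "T (rel D (\<alpha> \<cdot> suc k) y)" for y
          using decomposition_below[OF dec types y R\<^sub>0_step] min true_eMIN[OF \<alpha>] k that by blast
        then show "T (inst [suc k] (accA \<rho> D R (\<alpha> \<cdot> Bound 0)))"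
          unfolding inst using true_accA[OF types(2)] by blast
      qed
      then show ?thesis unfolding inst .
    qed
    show False using eWFA \<alpha> acc step by blast
  qed
  then show "\<forall>x. has_type [] x \<rho> \<longrightarrow> T (eWF \<rho> R x)" using eTP true_eTP by blast
qed

text \<open>The argument runs forwards instead of by contradiction: a sequence inside
  \<open>accA\<close> is minimal, so it fails to descend for \<open>R\<close> at some
  \<open>n\<close>, and by inclusion it fails for \<open>R\<^sub>0\<close> at the same
  \<open>n\<close>.\<close>

lemma eTP_if_sTP:
  assumes sub: "T (subrelation \<rho> R\<^sub>0 R)" and sTP: "T (sTP \<rho> D R R\<^sub>0)"
  shows "T (eTP \<rho> D R)"
  unfolding true_eTP
proof
  assume min: "\<forall>\<alpha>. has_type [] \<alpha> (TNat \<^bold>\<Rightarrow> \<rho>) \<longrightarrow> T (eMIN \<rho> D R \<alpha>) \<longrightarrow> T (WF R \<alpha>)"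
  have "\<exists>n. has_type [] n TNat \<and> \<not> T (rel R\<^sub>0 (\<alpha> \<cdot> n) (\<alpha> \<cdot> suc n))"
    if \<alpha>: "has_type [] \<alpha> (TNat \<^bold>\<Rightarrow> \<rho>)"
      and acc: "\<forall>n. has_type [] n TNat \<longrightarrow> T (accA \<rho> D R (\<alpha> \<cdot> n))" for \<alpha>
  proof -
    note [simp] = closed_simps[OF \<alpha>]
    have below: "T (eWF \<rho> R y)"
      if n: "has_type [] n TNat" and "has_type [] y \<rho>" "T (rel D (\<alpha> \<cdot> n) y)" for n y
    proof -
      have "has_type [] (\<alpha> \<cdot> n) \<rho>" using n by simp
      then show ?thesis using acc that true_accA by blast
    qed
    \<comment> \<open>Both conjuncts of minimality are instances of \<open>below\<close>, at index
      zero and at a successor.\<close>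
    have "T (eMIN \<rho> D R \<alpha>)"
      unfolding true_eMIN[OF \<alpha>] using below[of zero] below[of "suc _"] by simp
    then have "T (WF R \<alpha>)" using min \<alpha> by blast
    then obtain n where n: "has_type [] n TNat" and "\<not> T (rel R (\<alpha> \<cdot> n) (\<alpha> \<cdot> suc n))"
      using true_WF[OF \<alpha>] by blast
    then have "\<not> T (rel R\<^sub>0 (\<alpha> \<cdot> n) (\<alpha> \<cdot> suc n))"
      using subrelationD[OF sub, of "\<alpha> \<cdot> n" "\<alpha> \<cdot> suc n"] by auto
    then show ?thesis using n by blast
  qed
  then show "\<forall>x. has_type [] x \<rho> \<longrightarrow> T (eWF \<rho> R x)" using sTP true_sTP by blast
qed

end

theorem theorem3:
  fixes \<rho> :: ty and D R R\<^sub>0 :: fm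
  assumes "relation_on \<rho> D" and "relation_on \<rho> R" and "relation_on \<rho> R\<^sub>0"
  shows "PA_proves (decomposition \<rho> D R R\<^sub>0 \<^bold>\<longrightarrow> eTP \<rho> D R \<^bold>\<longrightarrow> sTP \<rho> D R R\<^sub>0) \<and>
         PA_proves (decomposition \<rho> D R R\<^sub>0 \<^bold>\<and> subrelation \<rho> R\<^sub>0 R \<^bold>\<longrightarrow>
           sTP \<rho> D R R\<^sub>0 \<^bold>\<longrightarrow> eTP \<rho> D R)"
proof -
  note wf = wf_fm_decomposition[OF assms] wf_fm_subrelation[OF assms(2,3)]
    wf_fm_eTP[OF assms(1,2)] wf_fm_sTP[OF assms]
  \<comment> \<open>In an arbitrary Henkin theory the object-level implications become implications
    between membership statements, which the two preceding lemmas prove.\<close>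
  have true: "T (decomposition \<rho> D R R\<^sub>0 \<^bold>\<longrightarrow> eTP \<rho> D R \<^bold>\<longrightarrow> sTP \<rho> D R R\<^sub>0) \<and>
      T (decomposition \<rho> D R R\<^sub>0 \<^bold>\<and> subrelation \<rho> R\<^sub>0 R \<^bold>\<longrightarrow> sTP \<rho> D R R\<^sub>0 \<^bold>\<longrightarrow> eTP \<rho> D R)"
    if "henkin_theory T" for T
  proof -
    interpret henkin_relations T \<rho> D R R\<^sub>0
      using that assms by (intro henkin_relations.intro henkin_relations_axioms.intro)
    show ?thesis using sTP_if_eTP eTP_if_sTP by (simp add: true_Imp true_And wf)
  qed
  show ?thesis
    by (intro conjI PA_proves_if_true_in_henkin_theories) (use true in \<open>simp add: wf | blast\<close>)+
qed

end
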